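(* Let $u\le w$ in $\mathbb{P}^*$ under generalized factor order, and let $C: w=v_0\to\dots\to v_n=u$ be a maximal chain of $[u,w]$ with chain id $l_1\cdots l_n$. Then $C(v_i,v_j)$ is a minimally skipped interval of $C$ if and only if one of the following holds: (a) $C(v_i,v_j)$ consists of a single strong descent; or (b) all of the following hold: $v_j$ is a principal factor of $v_i$; $l_{i+1}$ is the principal index of $v_j$ in $v_i$ (positions measured via the embedding of $v_i$ into $w$); and $C[v_i,v_j]$ is the first admissible chain in $[v_j,v_i]$ ending at the prefix embedding of $v_j$.
   Context: $\mathbb{P}=\{1,2,\dots\}$. Generalized factor order on $\mathbb{P}^*$: $u\le w$ iff $u(j)\le w(i+j)$ for all $1\le j\le|u|$, for some $i\ge 0$. Basic notions. - A word is flat if all its letters are $1$. - An embedding of $v$ into $w$ is $\eta\in0^*v0^*$ of length $|w|$ with $\eta(k)\le w(k)$ for all $k$. - In an embedding $\eta$ of $v$, the letter $\eta(k)$ is reducible if $\eta(k)>1$, or $\eta(k)=1$ is the first nonzero letter, or $v$ is not flat and $\eta(k)=1$ is the last nonzero letter. Reducing it subtracts $1$. - In a word $w$, $w(k)$ is reducible if $w(k)>1$, or $w(k)=1$ and $k=1$, or $w(k)=1$, $k=|w|$ and $w$ not flat. Chain ids. A maximal chain determines embeddings $\eta_{v_0}=w$, with $\eta_{v_k}$ obtained from $\eta_{v_{k-1}}$ by reducing the reducible letter at position $l_k$. This chain id is unique to the chain. Chains are ordered lexicographically by chain ids. A chain "ends at" the embedding $\eta_{v_n}$. The first admissible chain ending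 at an embedding $\eta$ of a non-flat word is the maximal chain ending at $\eta$ with lexicographically smallest chain id. - $v_k$ is a descent if $l_k>l_{k+1}$. - A descent is strong if $v_{k-1}\ne v_{k+1}11$. Skipped intervals. $C(v_i,v_j)=\{v_{i+1},\dots,v_{j-1}\}$. A nonempty $C(v_i,v_j)$ is skipped if $C\setminus C(v_i,v_j)\subseteq C'$ for some earlier maximal chain $C'$. It is minimally skipped if it properly contains no skipped interval. Principal factors. - Prefix: $|p|\le|w|$ and $p(k)\le w(k)$ for $k\le|p|$. Suffix: analogous, aligned at the end. Proper: $|p|<|w|$. - Outer factor: both a proper prefix and a proper suffix. Maximal outer factor: not contained in a longer outer factor. - For a non-flat maximal outer factor $p$ of $w$, its principal index is the least $k$ with $w(k)>p(k)$ ($p(k)=0$ for $k>|p|$) and $w(k)$ reducible. - $p$ is a principal factor if lowering $w(k)$ by $1$ gives a word no longer having $p$ as a suffix. *)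

theory Defs
  imports Main
begin

text \<open>Words are lists of natural numbers and positions are numbered from 0; all statements below
  involve positions only through comparisons and differences, so this is a uniform shift of the
  convention numbering them from 1.\<close>

definition Pstar :: "nat list set" where
  "Pstar = lists {1..}"

definition flat :: "nat list \<Rightarrow> bool" where
  "flat w \<longleftrightarrow> (\<forall>x\<in>set w. x = 1)"

definition gfo_le :: "nat list \<Rightarrow> nat list \<Rightarrow> bool" where
  "gfo_le u w \<longleftrightarrow> (\<exists>i. i + length u \<le> length w \<and> (\<forall>j<length u. u ! j \<le> w ! (i + j)))"

definition gfo_less :: "nat list \<Rightarrow> nat list \<Rightarrow> bool" where
  "gfo_less u w \<longleftrightarrow> gfo_le u w \<and> u \<noteq> w"

definition gfo_covers :: "nat list \<Rightarrow> nat list \<Rightarrow> bool" where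
  "gfo_covers w v \<longleftrightarrow> v \<in> Pstar \<and> w \<in> Pstar \<and> gfo_less v w \<and>
     \<not> (\<exists>z\<in>Pstar. gfo_less v z \<and> gfo_less z w)"

text \<open>A chain is listed from the top of the interval to the bottom.\<close>

definition maximal_chain :: "nat list \<Rightarrow> nat list \<Rightarrow> nat list list \<Rightarrow> bool" where
  "maximal_chain u w vs \<longleftrightarrow> vs \<noteq> [] \<and> hd vs = w \<and> last vs = u \<and>
     (\<forall>k. Suc k < length vs \<longrightarrow> gfo_covers (vs ! k) (vs ! Suc k))"

definition embedding :: "nat list \<Rightarrow> nat list \<Rightarrow> nat list \<Rightarrow> bool" where
  "embedding \<eta> v w \<longleftrightarrow> (\<exists>a b. \<eta> = replicate a 0 @ v @ replicate b 0) \<and>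
     length \<eta> = length w \<and> (\<forall>k<length w. \<eta> ! k \<le> w ! k)"

definition emb_reducible :: "nat list \<Rightarrow> nat list \<Rightarrow> nat \<Rightarrow> bool" where
  "emb_reducible v \<eta> k \<longleftrightarrow> k < length \<eta> \<and>
     (\<eta> ! k > 1 \<or>
      (\<eta> ! k = 1 \<and> (\<forall>i<k. \<eta> ! i = 0)) \<or>
      (\<not> flat v \<and> \<eta> ! k = 1 \<and> (\<forall>i. k < i \<and> i < length \<eta> \<longrightarrow> \<eta> ! i = 0)))"

definition emb_reduce :: "nat list \<Rightarrow> nat \<Rightarrow> nat list" where
  "emb_reduce \<eta> k = \<eta>[k := \<eta> ! k - 1]"

definition chain_emb :: "nat list \<Rightarrow> nat list \<Rightarrow> nat \<Rightarrow> nat list" where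
  "chain_emb w ls k = foldl emb_reduce w (take k ls)"

text \<open>The letter \<open>ls ! k\<close> is the position reduced in passing from \<open>vs ! k\<close> to \<open>vs ! Suc k\<close>; it is
  the entry written \<open>l\<close> with index \<open>k + 1\<close> in the usual numbering of chain ids.\<close>

definition chain_id :: "nat list list \<Rightarrow> nat list \<Rightarrow> bool" where
  "chain_id vs ls \<longleftrightarrow> length vs = Suc (length ls) \<and>
     (\<forall>k\<le>length ls. embedding (chain_emb (hd vs) ls k) (vs ! k) (hd vs)) \<and>
     (\<forall>k<length ls. emb_reducible (vs ! k) (chain_emb (hd vs) ls k) (ls ! k))"

definition earlier :: "nat list list \<Rightarrow> nat list list \<Rightarrow> bool" where
  "earlier vs' vs \<longleftrightarrow>
     (\<exists>ls' ls. chain_id vs' ls' \<and> chain_id vs ls \<and> (ls', ls) \<in> lexord less_than)"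

definition ends_at :: "nat list list \<Rightarrow> nat list \<Rightarrow> bool" where
  "ends_at vs \<eta> \<longleftrightarrow> (\<exists>ls. chain_id vs ls \<and> chain_emb (hd vs) ls (length ls) = \<eta>)"

definition first_admissible :: "nat list \<Rightarrow> nat list \<Rightarrow> nat list \<Rightarrow> nat list list \<Rightarrow> bool" where
  "first_admissible u w \<eta> vs \<longleftrightarrow> maximal_chain u w vs \<and> ends_at vs \<eta> \<and>
     (\<forall>vs'. maximal_chain u w vs' \<and> ends_at vs' \<eta> \<and> vs' \<noteq> vs \<longrightarrow> earlier vs vs')"

definition descent :: "nat list \<Rightarrow> nat \<Rightarrow> bool" where
  "descent ls k \<longleftrightarrow> 0 < k \<and> k < length ls \<and> ls ! (k - 1) > ls ! k"

definition strong_descent :: "nat list list \<Rightarrow> nat list \<Rightarrow> nat \<Rightarrow> bool" where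
  "strong_descent vs ls k \<longleftrightarrow> descent ls k \<and> vs ! (k - 1) \<noteq> vs ! (k + 1) @ [1, 1]"

definition open_int :: "nat list list \<Rightarrow> nat \<Rightarrow> nat \<Rightarrow> nat list set" where
  "open_int vs i j = {vs ! k | k. i < k \<and> k < j}"

definition subchain :: "nat list list \<Rightarrow> nat \<Rightarrow> nat \<Rightarrow> nat list list" where
  "subchain vs i j = map ((!) vs) [i..<Suc j]"

definition skipped :: "nat list \<Rightarrow> nat list \<Rightarrow> nat list list \<Rightarrow> nat \<Rightarrow> nat \<Rightarrow> bool" where
  "skipped u w vs i j \<longleftrightarrow> i < j \<and> j < length vs \<and> open_int vs i j \<noteq> {} \<and>
     (\<exists>vs'. maximal_chain u w vs' \<and> earlier vs' vs \<and> set vs - open_int vs i j \<subseteq> set vs')"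

definition minimally_skipped :: "nat list \<Rightarrow> nat list \<Rightarrow> nat list list \<Rightarrow> nat \<Rightarrow> nat \<Rightarrow> bool" where
  "minimally_skipped u w vs i j \<longleftrightarrow> skipped u w vs i j \<and>
     \<not> (\<exists>i' j'. skipped u w vs i' j' \<and> open_int vs i' j' \<subset> open_int vs i j)"

definition is_prefix :: "nat list \<Rightarrow> nat list \<Rightarrow> bool" where
  "is_prefix p w \<longleftrightarrow> length p \<le> length w \<and> (\<forall>k<length p. p ! k \<le> w ! k)"

definition is_suffix :: "nat list \<Rightarrow> nat list \<Rightarrow> bool" where
  "is_suffix p w \<longleftrightarrow> length p \<le> length w \<and>
     (\<forall>k<length p. p ! k \<le> w ! (length w - length p + k))"

definition outer_factor :: "nat list \<Rightarrow> nat list \<Rightarrow> bool" where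
  "outer_factor p w \<longleftrightarrow> p \<in> Pstar \<and> length p < length w \<and> is_prefix p w \<and> is_suffix p w"

text \<open>Only strictly longer outer factors are excluded; an outer factor of the same length that is
  larger letter by letter does not destroy maximality.\<close>

definition maximal_outer_factor :: "nat list \<Rightarrow> nat list \<Rightarrow> bool" where
  "maximal_outer_factor p w \<longleftrightarrow> outer_factor p w \<and>
     \<not> (\<exists>q. outer_factor q w \<and> length p < length q \<and> gfo_le p q)"

definition word_reducible :: "nat list \<Rightarrow> nat \<Rightarrow> bool" where
  "word_reducible w k \<longleftrightarrow> k < length w \<and>
     (w ! k > 1 \<or> (w ! k = 1 \<and> k = 0) \<or> (w ! k = 1 \<and> k = length w - 1 \<and> \<not> flat w))"

text \<open>A letter lowered to 0 is deleted.\<close>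

definition word_reduce :: "nat list \<Rightarrow> nat \<Rightarrow> nat list" where
  "word_reduce w k = filter (\<lambda>x. x \<noteq> 0) (w[k := w ! k - 1])"

text \<open>Meaningful for a non-flat outer factor \<open>p\<close> of \<open>w\<close>: then \<open>w\<close> is not flat, so its last letter
  is reducible and lies beyond the end of \<open>p\<close>, and the minimum exists.\<close>

definition principal_index :: "nat list \<Rightarrow> nat list \<Rightarrow> nat" where
  "principal_index p w =
     (LEAST k. word_reducible w k \<and> w ! k > (if k < length p then p ! k else 0))"

definition principal_factor :: "nat list \<Rightarrow> nat list \<Rightarrow> bool" where
  "principal_factor p w \<longleftrightarrow> maximal_outer_factor p w \<and> \<not> flat p \<and>
     \<not> is_suffix p (word_reduce w (principal_index p w))"

text \<open>The number of leading zeros of an embedding, which translates positions in a nonempty word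
  into positions in the embedding.\<close>

definition emb_offset :: "nat list \<Rightarrow> nat" where
  "emb_offset \<eta> = length (takeWhile (\<lambda>x. x = 0) \<eta>)"

definition prefix_embedding :: "nat list \<Rightarrow> nat list \<Rightarrow> nat list" where
  "prefix_embedding p w = p @ replicate (length w - length p) 0"

end

theory Submission
  imports Defs
begin

text \<open>
  An interval of a chain is skipped iff the corresponding subchain is not the lexicographically
  first chain between its end points. So it is minimally skipped iff the subchain is not
  lexicographically first but becomes so on removing either its top or its bottom element: the only
  possible improvement is then at the first step.

  If a descent can be swapped, the subchain has length two and is a strong descent. Otherwise
  every descent deletes two trailing ones. Then, for the subchain from \<open>w\<close> to \<open>u\<close>, no position
  smaller than the first reduced one can be used to reach the same embedding of \<open>u\<close>. Hence this
  embedding is the prefix one (otherwise the first letter could be reduced), the subchain is the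
  greedy one ending there, and its last step deletes a one, so its last word but one is \<open>u1\<close>. An
  improvement must use another occurrence of \<open>u\<close>; an inner occurrence would extend to one of \<open>u1\<close>
  and contradict minimality, so \<open>u\<close> occurs in \<open>w\<close> exactly as a prefix and as a suffix. This is
  maximality of the outer factor \<open>u\<close>, and the suffix occurrence must be destroyed by the first step,
  which is principality.
\<close>

section \<open>Embeddings and covers\<close>

text \<open>Two comparisons must be kept apart. A competing chain only has to reach the same word,
  by any occurrence: this is \<open>improvable\<close>. Being first among the chains with a
  prescribed end compares embeddings letter by letter: this is \<open>greedy\<close>. The gap
  between them is made of further occurrences of the final word, which is why outer factors enter.
  The letter sum is the rank of a word: it locates a word in every chain containing it, and chains
  with the same ends have ids of the same length. The suffix \<open>[1, 1]\<close> excluded from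
  strong descents comes from the rule for ones: apart from the first letter, a one becomes reducible
  only as last letter of a non-flat word, so a descent that cannot be swapped strips the last one
  and then the one before it. The recurrent test move is position 0: it is the smallest position, it
  is reducible in every nonempty word, and lowering it damages only the prefix occurrence. All this
  is done for a chain starting at a full word; a subchain starts at a word padded with zeros, and
  its positions are shifted by the number of leading zeros.\<close>

definition word_of :: "nat list \<Rightarrow> nat list" where
  "word_of e = filter (\<lambda>x. x \<noteq> 0) e"

text \<open>The case \<open>m = 0\<close> is allowed: the zero embedding has no canonical offset,
  and every \<open>a\<close> up to the length then serves.\<close>

definition supported :: "nat list \<Rightarrow> nat \<Rightarrow> nat \<Rightarrow> bool" where
  "supported e a m \<longleftrightarrow> a + m \<le> length e \<and>
     (\<forall>x<length e. e ! x \<noteq> 0 \<longleftrightarrow> a \<le> x \<and> x < a + m)"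

text \<open>The word is recovered from the embedding, so that chains can be followed through
  embeddings alone.\<close>

definition reducible :: "nat list \<Rightarrow> nat \<Rightarrow> bool" where
  "reducible e k \<longleftrightarrow> emb_reducible (word_of e) e k"

definition occurs_at :: "nat list \<Rightarrow> nat \<Rightarrow> nat list \<Rightarrow> bool" where
  "occurs_at u c e \<longleftrightarrow> c + length u \<le> length e \<and> (\<forall>y<length u. u ! y \<le> e ! (c + y))"

lemma gfo_le_iff: "gfo_le u e \<longleftrightarrow> (\<exists>c. occurs_at u c e)"
  by (simp add: gfo_le_def occurs_at_def)

lemma Pstar_iff: "w \<in> Pstar \<longleftrightarrow> (\<forall>x<length w. w ! x \<ge> 1)"
  by (auto simp: Pstar_def in_lists_conv_set all_set_conv_all_nth)

lemma supported_zero: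
  "supported e a m \<Longrightarrow> x < length e \<Longrightarrow> x < a \<or> a + m \<le> x \<Longrightarrow> e ! x = 0"
  unfolding supported_def by (metis linorder_not_le)

lemma supported_pos:
  "supported e a m \<Longrightarrow> a \<le> x \<Longrightarrow> x < a + m \<Longrightarrow> x < length e \<and> 0 < e ! x"
  by (auto simp: supported_def)

lemma supported_padded:
  assumes "v \<in> Pstar"
  shows "supported (replicate a 0 @ v @ replicate b 0) a (length v)"
proof -
  have "v ! y \<noteq> 0" if "y < length v" for y
    using assms that by (auto simp: Pstar_iff)
  then show ?thesis by (auto simp: supported_def nth_append)
qed

lemma word_of_Pstar: "word_of e \<in> Pstar"
  by (auto simp: word_of_def Pstar_def in_lists_conv_set)

lemma word_of_id: "v \<in> Pstar \<Longrightarrow> word_of v = v"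
  by (auto simp: word_of_def Pstar_def in_lists_conv_set filter_id_conv)

lemma word_of_padded: "word_of (replicate a 0 @ e @ replicate b 0) = word_of e"
  by (simp add: word_of_def)

lemma word_of_supported:
  assumes "supported e a m"
  shows "e = replicate a 0 @ word_of e @ replicate (length e - a - m) 0"
    and "length (word_of e) = m"
    and "\<And>y. y < m \<Longrightarrow> word_of e ! y = e ! (a + y)"
proof -
  define v where "v = take m (drop a e)"
  have len: "a + m \<le> length e" using assms by (simp add: supported_def)
  have v: "v \<in> Pstar"
    using assms by (auto simp: v_def Pstar_iff supported_def Suc_le_eq)
  have e: "e = replicate a 0 @ v @ replicate (length e - a - m) 0"
    using assms len by (intro nth_equalityI) (auto simp: v_def supported_def nth_append)
  have "word_of e = v"
    by (subst e) (simp add: word_of_padded word_of_id v)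
  with e show "e = replicate a 0 @ word_of e @ replicate (length e - a - m) 0" by simp
  show "length (word_of e) = m" using \<open>word_of e = v\<close> len by (simp add: v_def)
  show "\<And>y. y < m \<Longrightarrow> word_of e ! y = e ! (a + y)"
    using \<open>word_of e = v\<close> len by (simp add: v_def)
qed

lemma supported_Pstar: "w \<in> Pstar \<Longrightarrow> supported w 0 (length w)"
  by (auto simp: supported_def Pstar_iff)

lemma flat_word_of: "flat (word_of e) \<longleftrightarrow> (\<forall>x<length e. e ! x \<le> 1)"
proof -
  have "flat (word_of e) \<longleftrightarrow> (\<forall>x\<in>set e. x \<le> 1)"
    by (auto simp: flat_def word_of_def le_Suc_eq)
  then show ?thesis by (simp add: all_set_conv_all_nth)
qed

section \<open>A single reduction and its effect on the support\<close>

lemma length_emb_reduce [simp]: "length (emb_reduce e k) = length e"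
  by (simp add: emb_reduce_def)

lemma nth_emb_reduce:
  "x < length e \<Longrightarrow> emb_reduce e k ! x = (if x = k then e ! x - 1 else e ! x)"
  by (simp add: emb_reduce_def nth_list_update)

text \<open>A letter above 1 stays positive, while a one vanishes and shortens the support at one
  end. A word that is a single one is assigned to \<open>front\<close>, hence \<open>m > 1\<close>
  in \<open>rear\<close>.\<close>

lemma reducible_cases:
  assumes "supported e a m" "reducible e k"
  obtains (big) "k < length e" "e ! k > 1" "supported (emb_reduce e k) a m"
  | (front) "k < length e" "e ! k = 1" "k = a" "m > 0" "supported (emb_reduce e k) (Suc a) (m - 1)"
  | (rear) "e ! k = 1" "m > 1" "k = a + m - 1" "\<not> flat (word_of e)" "k < length e"
      "supported (emb_reduce e k) a (m - 1)"
proof -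
  have k: "k < length e" using assms(2) by (simp add: reducible_def emb_reducible_def)
  have s: "a + m \<le> length e" "\<And>x. x < length e \<Longrightarrow> e ! x \<noteq> 0 \<longleftrightarrow> a \<le> x \<and> x < a + m"
    using assms(1) by (auto simp: supported_def)
  consider "e ! k > 1" | "e ! k = 1" "\<forall>i<k. e ! i = 0"
    | "e ! k = 1" "\<not> flat (word_of e)" "\<forall>i. k < i \<and> i < length e \<longrightarrow> e ! i = 0" "\<exists>i<k. e ! i \<noteq> 0"
    using assms(2) unfolding reducible_def emb_reducible_def by blast
  then show thesis
  proof cases
    case 1
    then have "supported (emb_reduce e k) a m"
      using s s(2)[OF k] by (auto simp: supported_def nth_emb_reduce)
    with 1 k show ?thesis by (intro big)
  next
    case 2
    have ka: "a \<le> k" "k < a + m" using s(2)[OF k] 2 by auto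
    then have "e ! a \<noteq> 0" using s(2)[of a] k by auto
    then have "k = a" using 2 ka by (metis nat_less_le)
    moreover have "supported (emb_reduce e k) (Suc a) (m - 1)"
      using s k 2 ka \<open>k = a\<close> by (auto simp: supported_def nth_emb_reduce)
    ultimately show ?thesis using k 2 ka by (intro front) auto
  next
    case 3
    have ka: "a \<le> k" "k < a + m" using s(2)[OF k] 3 by auto
    have "a + m - 1 < length e" using s(1) ka by auto
    then have "e ! (a + m - 1) \<noteq> 0" using s(2)[of "a + m - 1"] ka by auto
    then have k': "k = a + m - 1" using 3 ka \<open>a + m - 1 < length e\<close>
      by (metis Suc_diff_1 less_Suc_eq less_antisym not_less_eq less_nat_zero_code neq0_conv)
    obtain i where "i < k" "e ! i \<noteq> 0" using 3 by auto
    then have m: "m > 1" using s(2)[of i] k k' by auto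
    have "supported (emb_reduce e k) a (m - 1)"
      using s k 3 ka k' m by (auto simp: supported_def nth_emb_reduce)
    then show ?thesis using 3 m k' k by (intro rear) auto
  qed
qed

lemma reducible_bounds:
  assumes "reducible e k"
  shows "k < length e" "e ! k \<ge> 1"
  using assms by (auto simp: reducible_def emb_reducible_def)

lemma reducible_big: "k < length e \<Longrightarrow> e ! k > 1 \<Longrightarrow> reducible e k"
  by (auto simp: reducible_def emb_reducible_def)

lemma reducible_first: "k < length e \<Longrightarrow> e ! k \<ge> 1 \<Longrightarrow> \<forall>i<k. e ! i = 0 \<Longrightarrow> reducible e k"
  by (auto simp: reducible_def emb_reducible_def le_Suc_eq Suc_le_eq)

lemma reducible_last:
  "k < length e \<Longrightarrow> e ! k \<ge> 1 \<Longrightarrow> \<not> flat (word_of e) \<Longrightarrow>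
    \<forall>i. k < i \<and> i < length e \<longrightarrow> e ! i = 0 \<Longrightarrow> reducible e k"
  by (auto simp: reducible_def emb_reducible_def le_Suc_eq Suc_le_eq)

lemma supported_reduce:
  assumes "supported e a m" "reducible e k"
  shows "\<exists>a m. supported (emb_reduce e k) a m"
  using assms by (cases rule: reducible_cases) auto

section \<open>Letter sum, occurrences and covers\<close>

lemma sum_list_word_of: "sum_list (word_of e) = sum_list e"
  by (induction e) (auto simp: word_of_def)

lemma sum_list_emb_reduce:
  assumes "reducible e k"
  shows "Suc (sum_list (emb_reduce e k)) = sum_list e"
proof -
  have "k < length e" "e ! k \<ge> 1" using reducible_bounds[OF assms] by auto
  then show ?thesis
    using member_le_sum_list[of "e ! k" e]
    by (auto simp: emb_reduce_def sum_list_update)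
qed

text \<open>The letters of \<open>u\<close> are positive, so an occurrence in a padded word cannot
  touch the zeros and only its offset changes. For empty \<open>u\<close> the two bounds would
  fail.\<close>

lemma occurs_at_word_of:
  assumes "supported e a m" "u \<in> Pstar" "u \<noteq> []"
  shows "occurs_at u c (word_of e) \<longleftrightarrow> occurs_at u (a + c) e"
    and "occurs_at u c e \<Longrightarrow> a \<le> c"
    and "occurs_at u c e \<Longrightarrow> c + length u \<le> a + m"
proof -
  note w = word_of_supported[OF assms(1)]
  have s: "a + m \<le> length e" "\<And>x. x < length e \<Longrightarrow> e ! x \<noteq> 0 \<longleftrightarrow> a \<le> x \<and> x < a + m"
    using assms(1) by (auto simp: supported_def)
  have len: "length u > 0" using assms by auto
  have pos: "\<And>y. y < length u \<Longrightarrow> u ! y \<ge> 1" using assms(2) by (simp add: Pstar_iff)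
  have b: "a \<le> c \<and> c + length u \<le> a + m" if o: "occurs_at u c e" for c
  proof -
    have "e ! c \<ge> 1" using o pos[of 0] len
      by (auto simp: occurs_at_def dest!: spec[of _ 0])
    moreover have "e ! (c + (length u - 1)) \<ge> 1"
      using o pos[of "length u - 1"] len
      by (auto simp: occurs_at_def dest!: spec[of _ "length u - 1"])
    moreover have "c < length e" "c + (length u - 1) < length e"
      using o len unfolding occurs_at_def by linarith+
    ultimately have "a \<le> c" "c + (length u - 1) < a + m"
      using s(2)[of c] s(2)[of "c + (length u - 1)"] by auto
    then show ?thesis using len by linarith
  qed
  then show "occurs_at u c e \<Longrightarrow> a \<le> c" "occurs_at u c e \<Longrightarrow> c + length u \<le> a + m" by auto
  show "occurs_at u c (word_of e) \<longleftrightarrow> occurs_at u (a + c) e"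
    using b[of "a + c"] w(2,3) s(1) by (auto simp: occurs_at_def add.assoc)
qed

lemma occurs_at_Nil [simp]: "occurs_at [] c e \<longleftrightarrow> c \<le> length e"
  by (simp add: occurs_at_def)

lemma gfo_le_word_of:
  assumes "supported e a m" "u \<in> Pstar"
  shows "gfo_le u (word_of e) \<longleftrightarrow> gfo_le u e"
proof (cases "u = []")
  case True
  then show ?thesis by (auto simp: gfo_le_iff)
next
  case False
  then show ?thesis
    using occurs_at_word_of[OF assms False] unfolding gfo_le_iff
    by (metis le_Suc_ex)
qed

lemma occurs_at_mono:
  "occurs_at u c e \<Longrightarrow> list_all2 (\<le>) e e' \<Longrightarrow> occurs_at u c e'"
  by (auto simp: occurs_at_def list_all2_conv_all_nth intro: order_trans)

lemma gfo_le_mono: "gfo_le u e \<Longrightarrow> list_all2 (\<le>) e e' \<Longrightarrow> gfo_le u e'"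
  by (auto simp: gfo_le_iff intro: occurs_at_mono)

lemma gfo_le_refl: "gfo_le u u"
  by (auto simp: gfo_le_iff occurs_at_def)

lemma gfo_le_trans: "gfo_le u v \<Longrightarrow> gfo_le v w \<Longrightarrow> gfo_le u w"
  unfolding gfo_le_def
proof (elim exE conjE)
  fix i i'
  assume a: "i + length u \<le> length v" "\<forall>j<length u. u ! j \<le> v ! (i + j)"
    "i' + length v \<le> length w" "\<forall>j<length v. v ! j \<le> w ! (i' + j)"
  have "u ! j \<le> w ! (i' + i + j)" if "j < length u" for j
    using a(2)[rule_format, OF that] a(4)[rule_format, of "i + j"] a(1) that by (simp add: add.assoc)
  then show "\<exists>i. i + length u \<le> length w \<and> (\<forall>j<length u. u ! j \<le> w ! (i + j))"
    using a by (intro exI[of _ "i' + i"]) auto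
qed

lemma emb_reduce_le: "list_all2 (\<le>) (emb_reduce e k) e"
  by (auto simp: list_all2_conv_all_nth nth_emb_reduce)

text \<open>The surplus of the larger word consists of the letters outside the occurrence, all
  positive, and of the letterwise differences; equal sums leave room for neither. So the letter sum
  is a rank function.\<close>

lemma gfo_le_sum_list:
  assumes "gfo_le u v" "v \<in> Pstar"
  shows "sum_list u \<le> sum_list v" "sum_list u = sum_list v \<Longrightarrow> u = v"
proof -
  obtain c where c: "c + length u \<le> length v" "\<And>y. y < length u \<Longrightarrow> u ! y \<le> v ! (c + y)"
    using assms(1) by (auto simp: gfo_le_def)
  define p where "p = take c v"
  define q where "q = take (length u) (drop c v)"
  define r where "r = drop (c + length u) v"
  have v: "v = p @ q @ r"
    by (simp add: p_def q_def r_def add.commute[of c] flip: drop_drop)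
  have uq: "list_all2 (\<le>) u q"
    using c by (auto simp: q_def list_all2_conv_all_nth)
  have pr: "p \<in> Pstar" "r \<in> Pstar"
    using assms(2) v by (auto simp: Pstar_def in_lists_conv_set)
  have le: "sum_list u \<le> sum_list q" using uq by (induction rule: list_all2_induct) auto
  then show "sum_list u \<le> sum_list v" using v by simp
  assume eq: "sum_list u = sum_list v"
  then have "sum_list p = 0" "sum_list r = 0" "sum_list u = sum_list q" using v le by auto
  then have "p = []" "r = []"
    using pr by (cases p; cases r; auto simp: Pstar_def)+
  moreover have "u = q" using uq \<open>sum_list u = sum_list q\<close>
  proof (induction rule: list_all2_induct)
    case (Cons x xs y ys)
    have "sum_list xs \<le> sum_list ys" using Cons.hyps(2)
      by (induction rule: list_all2_induct) auto
    then show ?case using Cons by auto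
  qed auto
  ultimately show "u = v" using v by simp
qed

text \<open>The letter sum drops by exactly one and is strictly increasing in the order, so no word
  fits in between.\<close>

lemma covers_reduce:
  assumes "supported e a m" "reducible e k"
  shows "gfo_covers (word_of e) (word_of (emb_reduce e k))"
proof -
  obtain a' m' where s': "supported (emb_reduce e k) a' m'"
    using supported_reduce[OF assms] by auto
  have le: "gfo_le (word_of (emb_reduce e k)) (word_of e)"
    using gfo_le_word_of[OF assms(1) word_of_Pstar] gfo_le_word_of[OF s' word_of_Pstar]
      gfo_le_mono[OF _ emb_reduce_le] gfo_le_refl by blast
  have sum: "Suc (sum_list (word_of (emb_reduce e k))) = sum_list (word_of e)"
    using sum_list_emb_reduce[OF assms(2)] by (simp add: sum_list_word_of)
  show ?thesis
    unfolding gfo_covers_def gfo_less_def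
  proof (intro conjI word_of_Pstar le)
    show "word_of (emb_reduce e k) \<noteq> word_of e" using sum by auto
    show "\<not> (\<exists>z\<in>Pstar. (gfo_le (word_of (emb_reduce e k)) z \<and> word_of (emb_reduce e k) \<noteq> z) \<and>
            gfo_le z (word_of e) \<and> z \<noteq> word_of e)"
    proof safe
      fix z assume z: "z \<in> Pstar" "gfo_le (word_of (emb_reduce e k)) z"
        "word_of (emb_reduce e k) \<noteq> z" "gfo_le z (word_of e)" "z \<noteq> word_of e"
      show False
        using gfo_le_sum_list[OF z(2,1)] gfo_le_sum_list[OF z(4) word_of_Pstar] z sum by linarith
    qed
  qed
qed

text \<open>Either some letter above 1 exceeds \<open>f\<close>, or the surplus lies outside the
  support of \<open>f\<close> and the end letter of \<open>e\<close> on that side can be lowered.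
  Non-flatness passes from \<open>f\<close> to \<open>e\<close>, and it is what permits lowering a
  last letter equal to 1.\<close>

lemma reduce_towards:
  assumes "supported e a m" "supported f b n" "list_all2 (\<le>) f e" "f \<noteq> e"
    and "\<not> flat (word_of f)"
  shows "\<exists>k. reducible e k \<and> list_all2 (\<le>) f (emb_reduce e k)"
proof -
  have len: "length f = length e" and le: "\<And>x. x < length e \<Longrightarrow> f ! x \<le> e ! x"
    using assms(3) by (auto simp: list_all2_conv_all_nth)
  have se: "a + m \<le> length e" "\<And>x. x < length e \<Longrightarrow> e ! x \<noteq> 0 \<longleftrightarrow> a \<le> x \<and> x < a + m"
    using assms(1) by (auto simp: supported_def)
  have sf: "b + n \<le> length f" "\<And>x. x < length f \<Longrightarrow> f ! x \<noteq> 0 \<longleftrightarrow> b \<le> x \<and> x < b + n"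
    using assms(2) by (auto simp: supported_def)
  have step: "list_all2 (\<le>) f (emb_reduce e k)" if "k < length e" "f ! k < e ! k" for k
    using that len le by (auto simp: list_all2_conv_all_nth nth_emb_reduce)
  obtain z where z: "z < length f" "f ! z > 1"
    using assms(5) len by (auto simp: flat_word_of not_le)
  then have nf: "\<not> flat (word_of e)"
    using le[of z] len by (auto simp: flat_word_of not_le intro!: exI[of _ z])
  obtain x where x: "x < length e" "f ! x < e ! x"
    using assms(4) le len nth_equalityI[of f e] by (metis le_neq_implies_less)
  show ?thesis
  proof (cases "e ! x > 1")
    case True
    then show ?thesis using x step reducible_big by blast
  next
    case False
    then have fx: "f ! x = 0" "e ! x = 1" using x by auto
    have ax: "a \<le> x" "x < a + m" using fx se(2)[OF x(1)] by auto
    show ?thesis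
    proof (cases "x < b")
      case True
      have "a < length e" "e ! a \<noteq> 0" "f ! a = 0" "\<forall>i<a. e ! i = 0"
        using supported_pos[OF assms(1), of a] supported_zero[OF assms(1)]
          supported_zero[OF assms(2), of a] x ax len True by auto
      then show ?thesis using step[of a] reducible_first[of a e] by (intro exI[of _ a]) auto
    next
      case False
      then have "x \<ge> b + n" using fx sf(2)[of x] x(1) len by auto
      define l where "l = a + m - 1"
      have "l < length e" using ax se(1) by (auto simp: l_def)
      moreover have "e ! l \<noteq> 0" using se(2)[OF \<open>l < length e\<close>] ax by (auto simp: l_def)
      moreover have "f ! l = 0"
        using sf(2)[of l] len \<open>l < length e\<close> \<open>x \<ge> b + n\<close> ax by (auto simp: l_def)
      moreover have "\<forall>i. l < i \<and> i < length e \<longrightarrow> e ! i = 0"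
        by (intro allI impI supported_zero[OF assms(1)]) (auto simp: l_def)
      ultimately show ?thesis
        using step[of l] reducible_last[of l e] nf by (intro exI[of _ l]) auto
    qed
  qed
qed

lemma embedding_of_occurrence:
  assumes "occurs_at u c e" "u \<in> Pstar"
  defines "f \<equiv> replicate c 0 @ u @ replicate (length e - c - length u) 0"
  shows "list_all2 (\<le>) f e" "supported f c (length u)" "word_of f = u"
proof -
  show "supported f c (length u)" "word_of f = u"
    using assms by (simp_all add: supported_padded word_of_padded word_of_id)
  have "f ! x \<le> e ! x" if "x < length e" for x
    using assms(1) that spec[of "\<lambda>y. y < length u \<longrightarrow> u ! y \<le> e ! (c + y)" "x - c"]
    by (auto simp: f_def occurs_at_def nth_append)
  then show "list_all2 (\<le>) f e"
    using assms(1) by (auto simp: list_all2_conv_all_nth f_def occurs_at_def)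
qed

text \<open>For non-flat \<open>u\<close> one moves towards a fixed occurrence. A flat
  \<open>u\<close> needs its own argument because the occurrence may have to move: in a flat word
  only the first letter can be deleted, after which \<open>u\<close> is found one place
  later.\<close>

lemma reduce_above:
  assumes "supported e a m" "u \<in> Pstar" "gfo_le u (word_of e)" "u \<noteq> word_of e"
  shows "\<exists>k. reducible e k \<and> gfo_le u (word_of (emb_reduce e k))"
proof -
  obtain c where c: "occurs_at u c e"
    using assms gfo_le_word_of[OF assms(1,2)] by (auto simp: gfo_le_iff)
  have "\<exists>k. reducible e k \<and> gfo_le u (emb_reduce e k)"
  proof (cases "flat u")
    case False
    note f = embedding_of_occurrence[OF c assms(2)]
    define f where "f = replicate c 0 @ u @ replicate (length e - c - length u) 0"
    have "f \<noteq> e" using f(3) assms(4) by (auto simp: f_def)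
    then obtain k where k: "reducible e k" "list_all2 (\<le>) f (emb_reduce e k)"
      using reduce_towards[OF assms(1) f(2,1)] False f(3) by (auto simp: f_def)
    have "gfo_le u f"
      using gfo_le_word_of[OF f(2) assms(2)] f(3) gfo_le_refl[of u] by (simp add: f_def)
    then show ?thesis using k gfo_le_mono by blast
  next
    case True
    then have u: "u ! y = 1" if "y < length u" for y using that by (simp add: flat_def)
    note w = word_of_supported[OF assms(1)]
    have s: "a + m \<le> length e" "\<And>x. x < length e \<Longrightarrow> e ! x \<noteq> 0 \<longleftrightarrow> a \<le> x \<and> x < a + m"
      using assms(1) by (auto simp: supported_def)
    have lu: "length u \<le> m" using assms(3) w(2) by (auto simp: gfo_le_def)
    show ?thesis
    proof (cases "flat (word_of e)")
      case False
      then obtain k where k: "k < length e" "e ! k > 1" by (auto simp: flat_word_of not_le)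
      have "emb_reduce e k ! (a + y) \<ge> 1" if "y < m" for y
        using s(1) s(2)[of "a + y"] that k by (auto simp: nth_emb_reduce)
      then have "occurs_at u a (emb_reduce e k)" using lu u s by (auto simp: occurs_at_def)
      then show ?thesis using k reducible_big by (auto simp: gfo_le_iff)
    next
      case fl: True
      have "length u \<noteq> m"
      proof
        assume "length u = m"
        then have "u = word_of e"
          using u fl w(2) by (intro nth_equalityI) (auto simp: flat_def all_set_conv_all_nth)
        then show False using assms(4) by simp
      qed
      then have lm: "length u < m" using lu by simp
      have "emb_reduce e a ! (Suc a + y) \<ge> 1" if "y < length u" for y
        using s(1) s(2)[of "Suc a + y"] that lm by (auto simp: nth_emb_reduce)
      then have "occurs_at u (Suc a) (emb_reduce e a)" using lm u s by (auto simp: occurs_at_def)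
      moreover have "reducible e a"
        using supported_pos[OF assms(1), of a] supported_zero[OF assms(1)] lm
        by (intro reducible_first) auto
      ultimately show ?thesis by (auto simp: gfo_le_iff)
    qed
  qed
  then obtain k where k: "reducible e k" "gfo_le u (emb_reduce e k)" by auto
  obtain a' m' where "supported (emb_reduce e k) a' m'"
    using supported_reduce[OF assms(1) k(1)] by auto
  from k gfo_le_word_of[OF this assms(2)] show ?thesis by auto
qed

text \<open>By \<open>reduce_above\<close> some reduction stays above \<open>v\<close>; being
  strictly below \<open>word_of e\<close>, it can only be \<open>v\<close> itself.\<close>

lemma covers_imp_reduce:
  assumes "supported e a m" "gfo_covers (word_of e) v"
  shows "\<exists>k. reducible e k \<and> word_of (emb_reduce e k) = v"
proof -
  have v: "v \<in> Pstar" "gfo_le v (word_of e)" "v \<noteq> word_of e"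
    "\<And>z. z \<in> Pstar \<Longrightarrow> gfo_le v z \<Longrightarrow> v \<noteq> z \<Longrightarrow> gfo_less z (word_of e) \<Longrightarrow> False"
    using assms(2) by (auto simp: gfo_covers_def gfo_less_def)
  obtain k where k: "reducible e k" "gfo_le v (word_of (emb_reduce e k))"
    using reduce_above[OF assms(1) v(1-3)] by auto
  have "gfo_less (word_of (emb_reduce e k)) (word_of e)"
    using covers_reduce[OF assms(1) k(1)] by (simp add: gfo_covers_def)
  then show ?thesis using v(4)[OF word_of_Pstar k(2)] k(1) by auto
qed

text \<open>If deleting the first letter and deleting the last letter give the same word, then that word is
  constant; this is what the flatness clause in reducibility excludes.\<close>

lemma reduce_inject:
  assumes "supported e a m" "reducible e k" "reducible e l"
    and "word_of (emb_reduce e k) = word_of (emb_reduce e l)"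
  shows "k = l"
proof -
  note w = word_of_supported
  have ends: False
    if s: "supported (emb_reduce e a) (Suc a) (m - 1)" "supported (emb_reduce e (a + m - 1)) a (m - 1)"
      and eq: "word_of (emb_reduce e a) = word_of (emb_reduce e (a + m - 1))"
      and "e ! a = 1" "m > 1" "\<not> flat (word_of e)"
  proof -
    have len: "a + m \<le> length e" using assms(1) by (simp add: supported_def)
    have shift: "e ! (Suc (a + y)) = e ! (a + y)" if "y < m - 1" for y
      using arg_cong[OF eq, of "\<lambda>x. x ! y"] w(3)[OF s(1) that] w(3)[OF s(2) that] that len
      by (auto simp: nth_emb_reduce)
    have "e ! (a + y) = 1" if "y < m" for y
      using that by (induction y) (use \<open>e ! a = 1\<close> shift in auto)
    then have "flat (word_of e)"
      using w(2,3)[OF assms(1)] by (auto simp: flat_def in_set_conv_nth)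
    with that show False by simp
  qed
  have bigs: "k = l" if "e ! k > 1" "k < length e" "supported (emb_reduce e k) a m"
    "l < length e" "supported (emb_reduce e l) a m"
  proof -
    have "emb_reduce e k = emb_reduce e l"
      using w(1)[OF that(3)] w(1)[OF that(5)] assms(4) by simp
    then have "emb_reduce e k ! k = emb_reduce e l ! k" by simp
    then show ?thesis using that by (auto simp: nth_emb_reduce split: if_splits)
  qed
  show ?thesis
    using assms(1,2)
  proof (cases rule: reducible_cases)
    case b: big
    from assms(1,3) show ?thesis
    proof (cases rule: reducible_cases)
      case big then show ?thesis using bigs b by blast
    next
      case front then show ?thesis using w(2)[OF b(3)] w(2)[OF front(5)] assms(4) by auto
    next
      case rear then show ?thesis using w(2)[OF b(3)] w(2)[OF rear(6)] assms(4) by auto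
    qed
  next
    case b: front
    from assms(1,3) show ?thesis
    proof (cases rule: reducible_cases)
      case big then show ?thesis using w(2)[OF b(5)] w(2)[OF big(3)] assms(4) b(4) by simp
    next
      case rear then show ?thesis using ends b assms(4) by auto
    qed (use b in auto)
  next
    case b: rear
    from assms(1,3) show ?thesis
    proof (cases rule: reducible_cases)
      case big then show ?thesis using w(2)[OF b(6)] w(2)[OF big(3)] assms(4) b(2) by simp
    next
      case front then show ?thesis using ends b assms(4) by auto
    qed (use b in auto)
  qed
qed

section \<open>Chains and skipped intervals\<close>

definition contiguous :: "nat list \<Rightarrow> bool" where
  "contiguous e \<longleftrightarrow> (\<exists>a m. supported e a m)"

text \<open>A chain id read from an arbitrary embedding; starting from embeddings rather than words
  makes the notion pass to tails.\<close>

fun run :: "nat list \<Rightarrow> nat list \<Rightarrow> bool" where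
  "run e [] \<longleftrightarrow> True"
| "run e (k # ls) \<longleftrightarrow> reducible e k \<and> run (emb_reduce e k) ls"

definition run_words :: "nat list \<Rightarrow> nat list \<Rightarrow> nat list list" where
  "run_words e ls = map (\<lambda>k. word_of (chain_emb e ls k)) [0..<Suc (length ls)]"

lemma contiguous_Pstar: "w \<in> Pstar \<Longrightarrow> contiguous w"
  using supported_Pstar contiguous_def by blast

lemma contiguous_reduce: "contiguous e \<Longrightarrow> reducible e k \<Longrightarrow> contiguous (emb_reduce e k)"
  using supported_reduce contiguous_def by blast

lemma chain_emb_0 [simp]: "chain_emb e ls 0 = e"
  by (simp add: chain_emb_def)

lemma chain_emb_Cons [simp]: "chain_emb e (l # ls) (Suc k) = chain_emb (emb_reduce e l) ls k"
  by (simp add: chain_emb_def)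

lemma chain_emb_Suc:
  "k < length ls \<Longrightarrow> chain_emb e ls (Suc k) = emb_reduce (chain_emb e ls k) (ls ! k)"
  by (simp add: chain_emb_def take_Suc_conv_app_nth)

lemma chain_emb_take: "k \<le> n \<Longrightarrow> chain_emb e (take n ls) k = chain_emb e ls k"
  by (simp add: chain_emb_def min_absorb1)

lemma chain_emb_drop:
  "i + k \<le> length ls \<Longrightarrow> chain_emb (chain_emb e ls i) (drop i ls) k = chain_emb e ls (i + k)"
  by (simp add: chain_emb_def take_add)

lemma run_append: "run e (ls @ ls') \<longleftrightarrow> run e ls \<and> run (chain_emb e ls (length ls)) ls'"
  by (induction ls arbitrary: e) auto

lemma run_nth: "run e ls \<longleftrightarrow> (\<forall>k<length ls. reducible (chain_emb e ls k) (ls ! k))"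
  by (induction ls arbitrary: e) (auto simp: All_less_Suc2)

lemma run_take: "run e ls \<Longrightarrow> run e (take k ls)"
  by (metis append_take_drop_id run_append)

lemma run_drop: "run e ls \<Longrightarrow> k \<le> length ls \<Longrightarrow> run (chain_emb e ls k) (drop k ls)"
  using run_append[of e "take k ls" "drop k ls"] by (simp add: min_absorb2 chain_emb_take)

lemma length_chain_emb [simp]: "length (chain_emb e ls k) = length e"
proof -
  have "length (foldl emb_reduce e ks) = length e" for ks
    by (induction ks arbitrary: e) auto
  then show ?thesis by (simp add: chain_emb_def)
qed

lemma contiguous_chain_emb: "contiguous e \<Longrightarrow> run e ls \<Longrightarrow> k \<le> length ls \<Longrightarrow> contiguous (chain_emb e ls k)"
  by (induction k) (auto simp: chain_emb_Suc run_nth contiguous_reduce)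

lemma sum_list_chain_emb:
  "run e ls \<Longrightarrow> k \<le> length ls \<Longrightarrow> sum_list (chain_emb e ls k) + k = sum_list e"
proof (induction k)
  case (Suc k)
  then show ?case
    using sum_list_emb_reduce[of "chain_emb e ls k" "ls ! k"] by (simp add: chain_emb_Suc run_nth)
qed simp

lemma chain_emb_antimono:
  assumes "i \<le> j" "j \<le> length ls"
  shows "list_all2 (\<le>) (chain_emb e ls j) (chain_emb e ls i)"
  using assms
proof (induction j rule: dec_induct)
  case base
  then show ?case by (simp add: list_all2_refl)
next
  case (step j)
  have "list_all2 (\<le>) (chain_emb e ls (Suc j)) (chain_emb e ls j)"
    using step.prems by (simp add: chain_emb_Suc emb_reduce_le)
  moreover have "list_all2 (\<le>) (chain_emb e ls j) (chain_emb e ls i)" using step by simp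
  ultimately show ?case
    unfolding list_all2_conv_all_nth by (metis order_trans)
qed

lemma gfo_le_contiguous:
  "contiguous e \<Longrightarrow> u \<in> Pstar \<Longrightarrow> gfo_le u (word_of e) \<longleftrightarrow> gfo_le u e"
  using gfo_le_word_of contiguous_def by blast

lemma gfo_le_chain_emb:
  assumes "contiguous e" "run e ls" "i \<le> j" "j \<le> length ls"
  shows "gfo_le (word_of (chain_emb e ls j)) (chain_emb e ls i)"
  using gfo_le_mono[OF _ chain_emb_antimono[OF assms(3,4)]] gfo_le_refl
    gfo_le_contiguous[OF contiguous_chain_emb[OF assms(1,2,4)] word_of_Pstar]
  by blast

lemma length_run_words [simp]: "length (run_words e ls) = Suc (length ls)"
  by (simp add: run_words_def)

lemma nth_run_words [simp]: "k \<le> length ls \<Longrightarrow> run_words e ls ! k = word_of (chain_emb e ls k)"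
  unfolding run_words_def by (subst nth_map) (auto simp del: upt_Suc)

lemma embedding_chain_emb:
  assumes "w \<in> Pstar" "run w ls" "k \<le> length ls"
  shows "embedding (chain_emb w ls k) (word_of (chain_emb w ls k)) w"
proof -
  obtain a m where "supported (chain_emb w ls k) a m"
    using contiguous_chain_emb[OF contiguous_Pstar] assms contiguous_def by blast
  from word_of_supported(1)[OF this] show ?thesis
    using chain_emb_antimono[of 0 k ls w] assms(3)
    unfolding embedding_def list_all2_conv_all_nth by auto
qed

lemma maximal_chain_run_words:
  assumes "w \<in> Pstar" "run w ls"
  shows "maximal_chain (word_of (chain_emb w ls (length ls))) w (run_words w ls)"
    and "chain_id (run_words w ls) ls"
proof -
  have ne: "run_words w ls \<noteq> []" by (auto simp: run_words_def)
  have hd: "hd (run_words w ls) = w" using ne assms by (simp add: hd_conv_nth word_of_id)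
  have last: "last (run_words w ls) = word_of (chain_emb w ls (length ls))"
    using ne by (simp add: last_conv_nth)
  have "gfo_covers (run_words w ls ! k) (run_words w ls ! Suc k)" if "k < length ls" for k
    using that covers_reduce contiguous_chain_emb[OF contiguous_Pstar[OF assms(1)] assms(2), of k]
      assms(2) by (auto simp: chain_emb_Suc contiguous_def run_nth)
  then show "maximal_chain (word_of (chain_emb w ls (length ls))) w (run_words w ls)"
    using ne hd last by (auto simp: maximal_chain_def)
  show "chain_id (run_words w ls) ls"
    using embedding_chain_emb[OF assms] assms hd
    by (auto simp: chain_id_def run_nth reducible_def)
qed

text \<open>Existence of chain ids. It is stated below an embedding because after one step the
  induction continues from an embedding that may contain zeros.\<close>

lemma maximal_chain_imp_run:
  assumes "maximal_chain u (word_of e) vs" "contiguous e"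
  shows "\<exists>ls. run e ls \<and> vs = run_words e ls"
  using assms
proof (induction vs arbitrary: e)
  case Nil
  then show ?case by (simp add: maximal_chain_def)
next
  case (Cons v vs)
  have v: "v = word_of e" using Cons.prems by (simp add: maximal_chain_def)
  show ?case
  proof (cases vs)
    case Nil
    then show ?thesis using v by (intro exI[of _ "[]"]) (simp add: run_words_def)
  next
    case (Cons v' vs')
    have "gfo_covers (word_of e) v'"
      using \<open>maximal_chain u (word_of e) (v # vs)\<close> Cons v
      by (auto simp: maximal_chain_def dest!: spec[of _ 0])
    then obtain k where k: "reducible e k" "word_of (emb_reduce e k) = v'"
      using covers_imp_reduce Cons.prems(2) contiguous_def by blast
    have "maximal_chain u v' vs"
      using \<open>maximal_chain u (word_of e) (v # vs)\<close> Cons by (fastforce simp: maximal_chain_def)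
    then obtain ls where ls: "run (emb_reduce e k) ls" "vs = run_words (emb_reduce e k) ls"
      using Cons.IH[of "emb_reduce e k"] k contiguous_reduce Cons.prems(2) by blast
    have "v # vs = run_words e (k # ls)"
      using v ls by (intro nth_equalityI) (auto simp: nth_Cons split: nat.splits)
    then show ?thesis using k ls by (intro exI[of _ "k # ls"]) simp
  qed
qed

text \<open>By \<open>reduce_inject\<close> the next word determines the next position, so ids agree
  as long as the words do. Uniqueness of chain ids follows.\<close>

lemma run_agree:
  assumes "contiguous e" "run e ls" "run e ls'"
    and "k \<le> length ls" "k \<le> length ls'" "\<And>m. m \<le> k \<Longrightarrow> run_words e ls ! m = run_words e ls' ! m"
  shows "take k ls = take k ls'"
  using assms(4-)
proof (induction k)
  case (Suc k)
  then have eq: "take k ls = take k ls'" by simp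
  then have E: "chain_emb e ls k = chain_emb e ls' k" by (simp add: chain_emb_def)
  have "word_of (emb_reduce (chain_emb e ls k) (ls ! k)) =
      word_of (emb_reduce (chain_emb e ls k) (ls' ! k))"
    using Suc.prems(1,2) Suc.prems(3)[of "Suc k"] E by (simp add: chain_emb_Suc)
  moreover have "contiguous (chain_emb e ls k)"
    using contiguous_chain_emb[OF assms(1,2), of k] Suc.prems by simp
  moreover have "reducible (chain_emb e ls k) (ls ! k)" "reducible (chain_emb e ls k) (ls' ! k)"
    using assms(2,3)[unfolded run_nth, rule_format, of k] Suc.prems(1,2) E by auto
  ultimately have "ls ! k = ls' ! k" using reduce_inject contiguous_def by blast
  then show ?case using eq Suc.prems by (simp add: take_Suc_conv_app_nth)
qed simp

lemma run_words_inject: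
  assumes "contiguous e" "run e ls" "run e ls'" "run_words e ls = run_words e ls'"
  shows "ls = ls'"
proof -
  have "length ls = length ls'" using assms(4) by (metis length_run_words nat.inject)
  then show ?thesis using run_agree[OF assms(1-3), of "length ls"] assms(4) by simp
qed

section \<open>Chain ids as runs, and completion to full chains\<close>

lemma embedding_word:
  assumes "embedding \<eta> v w" "v \<in> Pstar"
  shows "word_of \<eta> = v"
  using assms by (auto simp: embedding_def word_of_padded word_of_id)

lemma maximal_chain_Pstar:
  assumes "maximal_chain u w vs" "w \<in> Pstar" "v \<in> set vs"
  shows "v \<in> Pstar"
proof -
  obtain k where k: "k < length vs" "v = vs ! k" using assms(3) by (auto simp: in_set_conv_nth)
  show ?thesis
  proof (cases k)
    case 0
    then show ?thesis using assms k hd_conv_nth[of vs] by (auto simp: maximal_chain_def)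
  next
    case (Suc m)
    then have "gfo_covers (vs ! m) v" using assms(1) k by (simp add: maximal_chain_def)
    then show ?thesis by (simp add: gfo_covers_def)
  qed
qed

text \<open>The dictionary between chains with their ids and runs: an embedding determines its word,
  so the id determines the whole chain.\<close>

lemma chain_id_iff_run:
  assumes "w \<in> Pstar"
  shows "maximal_chain u w vs \<and> chain_id vs ls \<longleftrightarrow>
    run w ls \<and> vs = run_words w ls \<and> u = word_of (chain_emb w ls (length ls))"
    (is "?L \<longleftrightarrow> ?R")
proof
  assume ?R
  then show ?L using maximal_chain_run_words[OF assms] by auto
next
  assume L: ?L
  then have len: "length vs = Suc (length ls)" and hd: "hd vs = w"
    by (auto simp: chain_id_def maximal_chain_def)
  have w: "word_of (chain_emb w ls k) = vs ! k" if "k \<le> length ls" for k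
    using L that hd len maximal_chain_Pstar[of u w vs "vs ! k"] assms
    by (intro embedding_word[of _ _ w]) (auto simp: chain_id_def)
  then have "run w ls" using L hd by (auto simp: chain_id_def run_nth reducible_def)
  moreover have vs: "vs = run_words w ls" using len w by (intro nth_equalityI) auto
  moreover have "u = word_of (chain_emb w ls (length ls))"
    using L w len by (auto simp: maximal_chain_def last_conv_nth)
  ultimately show ?R by blast
qed

lemma exists_maximal_chain:
  assumes "u \<in> Pstar" "v \<in> Pstar" "gfo_le u v"
  shows "\<exists>vs. maximal_chain u v vs"
proof -
  have "\<exists>ls. run e ls \<and> word_of (chain_emb e ls (length ls)) = u"
    if "contiguous e" "gfo_le u (word_of e)" for e
    using that
  proof (induction "sum_list e" arbitrary: e rule: less_induct)
    case less
    show ?case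
    proof (cases "u = word_of e")
      case True
      then show ?thesis by (intro exI[of _ "[]"]) simp
    next
      case False
      obtain a m where "supported e a m" using less.prems by (auto simp: contiguous_def)
      from reduce_above[OF this assms(1) less.prems(2) False]
      obtain k where k: "reducible e k" "gfo_le u (word_of (emb_reduce e k))" by auto
      have "sum_list (emb_reduce e k) < sum_list e" using sum_list_emb_reduce[OF k(1)] by simp
      from less.hyps[OF this contiguous_reduce[OF less.prems(1) k(1)] k(2)]
      obtain ls where "run (emb_reduce e k) ls"
        "word_of (chain_emb (emb_reduce e k) ls (length ls)) = u" by auto
      then show ?thesis using k by (intro exI[of _ "k # ls"]) simp
    qed
  qed
  from this[OF contiguous_Pstar[OF assms(2)]] assms(2,3)
  show ?thesis using maximal_chain_run_words[OF assms(2)] by (metis word_of_id)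
qed

text \<open>In contrast to \<open>exists_maximal_chain\<close>, the final embedding is prescribed.
  For a flat target this can fail, since a flat word does not lose its last one unless that is also
  its first letter.\<close>

lemma run_to_embedding:
  assumes "contiguous e" "contiguous f" "list_all2 (\<le>) f e" "\<not> flat (word_of f)"
  shows "\<exists>ls. run e ls \<and> chain_emb e ls (length ls) = f"
  using assms
proof (induction "sum_list e" arbitrary: e rule: less_induct)
  case less
  show ?case
  proof (cases "f = e")
    case True
    then show ?thesis by (intro exI[of _ "[]"]) simp
  next
    case False
    obtain k where k: "reducible e k" "list_all2 (\<le>) f (emb_reduce e k)"
      using reduce_towards False less.prems unfolding contiguous_def by blast
    have "sum_list (emb_reduce e k) < sum_list e" using sum_list_emb_reduce[OF k(1)] by simp
    from less.hyps[OF this contiguous_reduce[OF less.prems(1) k(1)] less.prems(2) k(2) less.prems(4)]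
    obtain ls where "run (emb_reduce e k) ls" "chain_emb (emb_reduce e k) ls (length ls) = f"
      by auto
    then show ?thesis using k by (intro exI[of _ "k # ls"]) simp
  qed
qed

text \<open>\<open>lexord\<close> also places a proper prefix before its extension; equal length
  excludes this case.\<close>

lemma lexord_first_difference:
  assumes "(xs, ys) \<in> lexord less_than" "length xs = length ys"
  obtains k where "k < length ys" "take k xs = take k ys" "xs ! k < (ys ! k :: nat)"
proof -
  consider "\<exists>a v. ys = xs @ a # v"
    | u a b v w where "(a, b) \<in> less_than" "xs = u @ a # v" "ys = u @ b # w"
    using assms(1) by (auto simp: lexord_def)
  then show ?thesis
  proof cases
    case 1
    then show ?thesis using assms(2) by auto
  next
    case 2
    then show ?thesis by (intro that[of "length u"]) auto
  qed
qed

lemma lexord_at: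
  assumes "k < length xs" "k < length ys" "take k xs = take k ys" "xs ! k < (ys ! k :: nat)"
  shows "(xs, ys) \<in> lexord less_than"
proof -
  have "xs = take k xs @ xs ! k # drop (Suc k) xs" "ys = take k xs @ ys ! k # drop (Suc k) ys"
    using id_take_nth_drop[OF assms(1)] id_take_nth_drop[OF assms(2)] assms(3) by simp_all
  then show ?thesis using assms(4) unfolding lexord_def by blast
qed

section \<open>Lexicographic improvements of a chain\<close>

lemma sum_list_nth_run_words:
  "run e ls \<Longrightarrow> k \<le> length ls \<Longrightarrow> sum_list (run_words e ls ! k) + k = sum_list e"
  using sum_list_chain_emb by (simp add: sum_list_word_of)

text \<open>Since every word above the target can be completed to a chain, this says that the chain is not
  the lexicographically first one between its two ends.\<close>

definition improvable :: "nat list \<Rightarrow> nat list \<Rightarrow> bool" where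
  "improvable e ls \<longleftrightarrow> (\<exists>k<length ls. \<exists>l<ls ! k. reducible (chain_emb e ls k) l \<and>
     gfo_le (word_of (chain_emb e ls (length ls))) (emb_reduce (chain_emb e ls k) l))"

text \<open>A competitor for a single step would give a word above the final one with the same
  letter sum, hence the same word, and \<open>reduce_inject\<close> identifies the
  positions.\<close>

lemma improvable_length:
  assumes "contiguous e" "run e ls" "improvable e ls"
  shows "2 \<le> length ls"
proof (rule ccontr)
  assume "\<not> 2 \<le> length ls"
  moreover obtain k l where k: "k < length ls" "l < ls ! k" "reducible (chain_emb e ls k) l"
    "gfo_le (word_of (chain_emb e ls (length ls))) (emb_reduce (chain_emb e ls k) l)"
    using assms(3) by (auto simp: improvable_def)
  ultimately have len: "length ls = Suc 0" "k = 0" by auto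
  have r: "reducible e (ls ! 0)" using assms(2) len by (simp add: run_nth)
  have E: "chain_emb e ls (length ls) = emb_reduce e (ls ! 0)"
    using len by (simp add: chain_emb_Suc)
  have "gfo_le (word_of (emb_reduce e (ls ! 0))) (word_of (emb_reduce e l))"
    using k len E assms(1) by (simp add: gfo_le_contiguous contiguous_reduce word_of_Pstar)
  moreover have "sum_list (word_of (emb_reduce e (ls ! 0))) = sum_list (word_of (emb_reduce e l))"
    using sum_list_emb_reduce[OF r] sum_list_emb_reduce[of e l] k len
    by (simp add: sum_list_word_of)
  ultimately have "word_of (emb_reduce e (ls ! 0)) = word_of (emb_reduce e l)"
    using gfo_le_sum_list(2)[OF _ word_of_Pstar] by blast
  then have "ls ! 0 = l"
    using reduce_inject r k len assms(1) unfolding contiguous_def by (metis chain_emb_0)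
  then show False using k len by simp
qed

lemma improvable_segment:
  assumes "i \<le> j" "j \<le> length ls"
  shows "improvable (chain_emb e ls i) (take (j - i) (drop i ls)) \<longleftrightarrow>
    (\<exists>k. i \<le> k \<and> k < j \<and> (\<exists>l<ls ! k. reducible (chain_emb e ls k) l \<and>
      gfo_le (word_of (chain_emb e ls j)) (emb_reduce (chain_emb e ls k) l)))"
proof -
  have E: "chain_emb (chain_emb e ls i) (take (j - i) (drop i ls)) k = chain_emb e ls (i + k)"
    if "k \<le> j - i" for k
    using that assms by (simp add: chain_emb_take chain_emb_drop)
  have len: "length (take (j - i) (drop i ls)) = j - i" using assms by simp
  show ?thesis
  proof
    assume "improvable (chain_emb e ls i) (take (j - i) (drop i ls))"
    then obtain k l where "k < j - i" "l < ls ! (i + k)" "reducible (chain_emb e ls (i + k)) l"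
      "gfo_le (word_of (chain_emb e ls j)) (emb_reduce (chain_emb e ls (i + k)) l)"
      using len E assms by (auto simp: improvable_def)
    then show "\<exists>k. i \<le> k \<and> k < j \<and> (\<exists>l<ls ! k. reducible (chain_emb e ls k) l \<and>
      gfo_le (word_of (chain_emb e ls j)) (emb_reduce (chain_emb e ls k) l))"
      by (intro exI[of _ "i + k"]) auto
  next
    assume "\<exists>k. i \<le> k \<and> k < j \<and> (\<exists>l<ls ! k. reducible (chain_emb e ls k) l \<and>
      gfo_le (word_of (chain_emb e ls j)) (emb_reduce (chain_emb e ls k) l))"
    then obtain k l where "i \<le> k" "k < j" "l < ls ! k" "reducible (chain_emb e ls k) l"
      "gfo_le (word_of (chain_emb e ls j)) (emb_reduce (chain_emb e ls k) l)" by auto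
    then show "improvable (chain_emb e ls i) (take (j - i) (drop i ls))"
      using len E assms unfolding improvable_def by (intro exI[of _ "k - i"]) auto
  qed
qed

text \<open>A reduction that stays above the last word of the inner segment also stays above every
  later word.\<close>

lemma improvable_segment_mono:
  assumes "contiguous e" "run e ls" "i \<le> i'" "i' \<le> j'" "j' \<le> j" "j \<le> length ls"
    and "improvable (chain_emb e ls i') (take (j' - i') (drop i' ls))"
  shows "improvable (chain_emb e ls i) (take (j - i) (drop i ls))"
proof -
  have j': "i' \<le> j'" "j' \<le> length ls" and j: "i \<le> j" "j \<le> length ls" using assms by auto
  have "gfo_le (word_of (chain_emb e ls j)) (word_of (chain_emb e ls j'))"
    using gfo_le_chain_emb[OF assms(1,2), of j' j] assms
    by (simp add: gfo_le_contiguous contiguous_chain_emb word_of_Pstar)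
  then show ?thesis
    using assms(3,5,7) gfo_le_trans unfolding improvable_segment[OF j'] improvable_segment[OF j]
    by (meson order_less_le_trans order_trans)
qed

lemma run_words_distinct:
  assumes "run e ls" "i \<le> length ls" "j \<le> length ls" "run_words e ls ! i = run_words e ls ! j"
  shows "i = j"
  using sum_list_nth_run_words[OF assms(1,2)] sum_list_nth_run_words[OF assms(1,3)] assms(4) by simp

lemma maximal_chain_detour:
  assumes "maximal_chain u w vs" "k < j" "j < length vs"
    and "gfo_covers (vs ! k) v" "maximal_chain (vs ! j) v vs'"
  shows "maximal_chain u w (take (Suc k) vs @ vs' @ drop (Suc j) vs)"
proof -
  define A where "A = take (Suc k) vs"
  define B where "B = drop (Suc j) vs"
  have cov: "\<And>m. Suc m < length vs \<Longrightarrow> gfo_covers (vs ! m) (vs ! Suc m)"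
    and cov': "\<And>m. Suc m < length vs' \<Longrightarrow> gfo_covers (vs' ! m) (vs' ! Suc m)"
    using assms by (auto simp: maximal_chain_def)
  have ne: "vs' \<noteq> []" "vs \<noteq> []" "hd vs' = v" "last vs' = vs ! j" "hd vs = w" "last vs = u"
    using assms by (auto simp: maximal_chain_def)
  have lA: "length A = Suc k" using assms by (simp add: A_def)
  have lB: "length B = length vs - Suc j" by (simp add: B_def)
  have last: "last (A @ vs' @ B) = u"
  proof (cases "B = []")
    case True
    then have "length vs = Suc j" using assms(3) by (simp add: B_def)
    then show ?thesis using True ne last_conv_nth[of vs] by simp
  next
    case False
    then show ?thesis using ne by (simp add: B_def)
  qed
  have hd: "hd (A @ vs' @ B) = w" using ne by (simp add: A_def)
  have "gfo_covers ((A @ vs' @ B) ! m) ((A @ vs' @ B) ! Suc m)"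
    if m: "Suc m < length (A @ vs' @ B)" for m
  proof -
    \<comment> \<open>The two seams are the step into \<open>vs'\<close> at \<open>m = k\<close> and
      the step out of \<open>vs'\<close> in the fourth case; elsewhere both words come from the same
      piece.\<close>
    consider "m < k" | "m = k" | r where "m = Suc k + r" "Suc r < length vs'"
      | "m = Suc k + (length vs' - 1)" | r where "m = Suc k + length vs' + r"
    proof (cases "m \<le> k")
      case True
      then show ?thesis using that(1,2) by linarith
    next
      case False
      then obtain r where r: "m = Suc k + r" by (metis less_iff_Suc_add not_le add_Suc)
      show ?thesis
      proof (cases "r < length vs'")
        case True
        then show ?thesis using that(3,4) r by (cases "Suc r = length vs'") auto
      next
        case False
        then show ?thesis using that(5)[of "r - length vs'"] r by simp
      qed
    qed
    then show ?thesis
    proof cases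
      case 1
      then show ?thesis using cov[of m] assms lA by (simp add: nth_append A_def)
    next
      case 2
      then show ?thesis using ne lA assms by (simp add: nth_append A_def hd_conv_nth)
    next
      case (3 r)
      then show ?thesis using cov'[of r] lA by (simp add: nth_append)
    next
      case 4
      then have "(A @ vs' @ B) ! m = vs ! j" "(A @ vs' @ B) ! Suc m = vs ! Suc j"
        using ne lA m lB by (auto simp: nth_append last_conv_nth B_def)
      then show ?thesis using cov[of j] m 4 lA lB ne by auto
    next
      case (5 r)
      then have "(A @ vs' @ B) ! m = vs ! (Suc j + r)" "(A @ vs' @ B) ! Suc m = vs ! (Suc j + Suc r)"
        using lA m lB by (auto simp: nth_append B_def)
      then show ?thesis using cov[of "Suc j + r"] m 5 lA lB by auto
    qed
  qed
  then show ?thesis using ne hd last unfolding A_def[symmetric] B_def[symmetric] maximal_chain_def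
    by auto
qed

text \<open>Forward, the first difference of the ids lies inside the interval and the earlier chain
  still passes through the word at \<open>j\<close>, so its smaller position is an improvement.
  Backward, an improvement is completed to a chain down to the word at \<open>j\<close> and spliced
  in.\<close>

lemma skipped_iff_improvable:
  assumes "w \<in> Pstar" "run w ls" "u = word_of (chain_emb w ls (length ls))"
    and "i < j" "j \<le> length ls"
  shows "skipped u w (run_words w ls) i j \<longleftrightarrow>
    improvable (chain_emb w ls i) (take (j - i) (drop i ls))"
proof
  let ?vs = "run_words w ls"
  note con = contiguous_Pstar[OF assms(1)]
  note seg = improvable_segment[OF less_imp_le[OF assms(4)] assms(5)]
  {
    assume "skipped u w ?vs i j"
    then obtain vs' where vs': "maximal_chain u w vs'" "earlier vs' ?vs"
      "set ?vs - open_int ?vs i j \<subseteq> set vs'" by (auto simp: skipped_def)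
    obtain ls' ls0 where "chain_id vs' ls'" "chain_id ?vs ls0" "(ls', ls0) \<in> lexord less_than"
      using vs'(2) by (auto simp: earlier_def)
    moreover have "maximal_chain u w ?vs" using maximal_chain_run_words[OF assms(1,2)] assms(3) by simp
    ultimately have ls': "run w ls'" "vs' = run_words w ls'"
      "u = word_of (chain_emb w ls' (length ls'))" and "run w ls0" "?vs = run_words w ls0"
      and lex: "(ls', ls0) \<in> lexord less_than"
      using chain_id_iff_run[OF assms(1)] vs'(1) by blast+
    then have "ls0 = ls" using run_words_inject[OF con assms(2)] by auto
    have len: "length ls' = length ls"
      using sum_list_chain_emb[OF ls'(1), of "length ls'"] sum_list_chain_emb[OF assms(2), of "length ls"]
        arg_cong[OF ls'(3), of sum_list] assms(3) by (simp add: sum_list_word_of)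
    \<comment> \<open>Words outside the interval survive in \<open>vs'\<close>, and the letter sum
      forces them to sit at the same index.\<close>
    have agree: "run_words w ls' ! k = ?vs ! k" if "k \<le> i \<or> j \<le> k" "k \<le> length ls" for k
    proof -
      have "?vs ! k \<notin> open_int ?vs i j"
      proof
        assume "?vs ! k \<in> open_int ?vs i j"
        then obtain m where "i < m" "m < j" "?vs ! k = ?vs ! m" by (auto simp: open_int_def)
        then show False using that run_words_distinct[OF assms(2), of k m] assms(5) by simp
      qed
      then have "?vs ! k \<in> set vs'" using vs'(3) that nth_mem[of k ?vs] by auto
      then obtain k' where k': "k' \<le> length ls" "?vs ! k = run_words w ls' ! k'"
        using ls'(2) len by (auto simp: in_set_conv_nth less_Suc_eq_le)
      then have "k' = k"
        using sum_list_nth_run_words[OF assms(2) that(2)] sum_list_nth_run_words[OF ls'(1), of k'] len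
        by simp
      then show ?thesis using k' by simp
    qed
    obtain k where k: "k < length ls" "take k ls' = take k ls" "ls' ! k < ls ! k"
      using lexord_first_difference[OF lex] len \<open>ls0 = ls\<close> by auto
    have Ek: "chain_emb w ls' k = chain_emb w ls k" using k by (simp add: chain_emb_def)
    have r: "reducible (chain_emb w ls k) (ls ! k)" "reducible (chain_emb w ls k) (ls' ! k)"
      using assms(2) ls'(1) k Ek len by (auto simp: run_nth)
    \<comment> \<open>If the word at \<open>Suc k\<close> were outside the interval, it would be
      common to both chains, and \<open>reduce_inject\<close> would give equal positions at
      \<open>k\<close>.\<close>
    have "\<not> (Suc k \<le> i \<or> j \<le> Suc k \<and> j \<le> k)"
    proof
      assume "Suc k \<le> i \<or> j \<le> Suc k \<and> j \<le> k"
      then have "word_of (emb_reduce (chain_emb w ls k) (ls ! k)) =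
          word_of (emb_reduce (chain_emb w ls k) (ls' ! k))"
        using agree[of "Suc k"] k len Ek by (auto simp: chain_emb_Suc)
      then have "ls ! k = ls' ! k"
        using reduce_inject r contiguous_chain_emb[OF con assms(2), of k] k(1)
        unfolding contiguous_def by (meson less_imp_le)
      then show False using k by simp
    qed
    then have ik: "i \<le> k" "k < j" by auto
    have "gfo_le (word_of (chain_emb w ls' j)) (chain_emb w ls' (Suc k))"
      using gfo_le_chain_emb[OF con ls'(1)] ik assms(5) len by simp
    then have "gfo_le (word_of (chain_emb w ls j)) (emb_reduce (chain_emb w ls k) (ls' ! k))"
      using agree[of j] assms(5) len Ek k by (simp add: chain_emb_Suc)
    then show "improvable (chain_emb w ls i) (take (j - i) (drop i ls))"
      unfolding seg using ik k r by blast
  next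
    assume imp: "improvable (chain_emb w ls i) (take (j - i) (drop i ls))"
    have "contiguous (chain_emb w ls i)" "run (chain_emb w ls i) (take (j - i) (drop i ls))"
      using contiguous_chain_emb[OF con assms(2)] run_take run_drop[OF assms(2)] assms(4,5) by auto
    \<comment> \<open>Two steps are what makes the open interval nonempty.\<close>
    from improvable_length[OF this imp] have ij: "2 \<le> j - i" by simp
    obtain k l where k: "i \<le> k" "k < j" "l < ls ! k" "reducible (chain_emb w ls k) l"
      "gfo_le (word_of (chain_emb w ls j)) (emb_reduce (chain_emb w ls k) l)"
      using imp unfolding seg by auto
    have ck: "contiguous (chain_emb w ls k)"
      using contiguous_chain_emb[OF con assms(2), of k] k assms(5) by simp
    define v where "v = word_of (emb_reduce (chain_emb w ls k) l)"
    have "gfo_le (?vs ! j) v"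
      using k assms(5) gfo_le_contiguous[OF contiguous_reduce[OF ck k(4)] word_of_Pstar]
      by (simp add: v_def)
    then obtain vs1 where vs1: "maximal_chain (?vs ! j) v vs1"
      using exists_maximal_chain[of "?vs ! j" v] assms(5) by (auto simp: v_def word_of_Pstar)
    define vs' where "vs' = take (Suc k) ?vs @ vs1 @ drop (Suc j) ?vs"
    have "gfo_covers (?vs ! k) v"
      using covers_reduce ck k assms(5) by (auto simp: v_def contiguous_def)
    then have mc: "maximal_chain u w vs'"
      unfolding vs'_def using maximal_chain_run_words(1)[OF assms(1,2)] vs1 k assms
      by (intro maximal_chain_detour) auto
    then obtain ls' where ls': "run w ls'" "vs' = run_words w ls'"
      using maximal_chain_imp_run[of u w vs'] con word_of_id[OF assms(1)] by auto
    have "vs1 \<noteq> []" "hd vs1 = v" using vs1 by (auto simp: maximal_chain_def)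
    have len': "Suc k \<le> length ls'"
      using arg_cong[OF ls'(2), of length] \<open>vs1 \<noteq> []\<close> k assms(5)
      by (cases vs1) (auto simp: vs'_def)
    have nth: "vs' ! m = ?vs ! m" if "m \<le> k" for m
      using that k assms(5) by (simp add: vs'_def nth_append)
    have "take k ls = take k ls'"
      using nth ls' len' k assms(5) by (intro run_agree[OF con assms(2) ls'(1)]) auto
    then have Ek: "chain_emb w ls' k = chain_emb w ls k" by (simp add: chain_emb_def)
    have "vs' ! Suc k = v"
      using \<open>vs1 \<noteq> []\<close> \<open>hd vs1 = v\<close> k assms(5) by (simp add: vs'_def nth_append hd_conv_nth)
    then have "word_of (emb_reduce (chain_emb w ls k) (ls' ! k)) = v"
      using ls' len' Ek by (simp add: chain_emb_Suc)
    moreover have "reducible (chain_emb w ls k) (ls' ! k)"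
      using ls'(1) len' Ek by (simp add: run_nth flip: Ek)
    \<comment> \<open>The id of the spliced chain is only known to exist; that the chain passes
      through \<open>v\<close> right after index \<open>k\<close> fixes its entry there.\<close>
    ultimately have "ls' ! k = l"
      using reduce_inject k(4) ck unfolding v_def contiguous_def by blast
    then have "(ls', ls) \<in> lexord less_than"
      using k len' assms(5) \<open>take k ls = take k ls'\<close> by (intro lexord_at[of k]) auto
    moreover have "chain_id vs' ls'" using maximal_chain_run_words(2)[OF assms(1) ls'(1)] ls'(2) by simp
    ultimately have "earlier vs' ?vs"
      using maximal_chain_run_words(2)[OF assms(1,2)] unfolding earlier_def by blast
    moreover have "set ?vs - open_int ?vs i j \<subseteq> set vs'"
    proof
      fix x assume x: "x \<in> set ?vs - open_int ?vs i j"
      then obtain m where m: "m \<le> length ls" "x = ?vs ! m"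
        by (auto simp: in_set_conv_nth less_Suc_eq_le)
      then have "\<not> (i < m \<and> m < j)" using x unfolding open_int_def by blast
      then consider "m \<le> i" | "m = j" | "j < m" by linarith
      then show "x \<in> set vs'"
      proof cases
        case 1
        then show ?thesis
          using m k assms(5) nth[of m] len' ls'(2) nth_mem[of m vs'] by simp
      next
        case 2
        then have "x = last vs1" using vs1 m by (simp add: maximal_chain_def)
        then show ?thesis using \<open>vs1 \<noteq> []\<close> by (simp add: vs'_def)
      next
        case 3
        then have "x = drop (Suc j) ?vs ! (m - Suc j)" using m by simp
        moreover have "m - Suc j < length (drop (Suc j) ?vs)" using m 3 by simp
        ultimately have "x \<in> set (drop (Suc j) ?vs)" using nth_mem by metis
        then show ?thesis by (simp add: vs'_def)
      qed
    qed
    moreover have "open_int ?vs i j \<noteq> {}" using ij unfolding open_int_def by (auto intro!: exI[of _ "Suc i"])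
    ultimately show "skipped u w ?vs i j"
      using mc assms(4,5) unfolding skipped_def by auto
  }
qed

section \<open>Descents\<close>

lemma chain_emb_le:
  "i \<le> j \<Longrightarrow> j \<le> length ls \<Longrightarrow> x < length e \<Longrightarrow> chain_emb e ls j ! x \<le> chain_emb e ls i ! x"
  using chain_emb_antimono[of i j ls e] by (simp add: list_all2_conv_all_nth)

lemma chain_emb_unchanged:
  assumes "i \<le> j" "j \<le> length ls" "x < length e" "\<And>t. i \<le> t \<Longrightarrow> t < j \<Longrightarrow> ls ! t \<noteq> x"
  shows "chain_emb e ls j ! x = chain_emb e ls i ! x"
  using assms by (induction j rule: dec_induct) (auto simp: chain_emb_Suc nth_emb_reduce)

lemma step_dropping_to_zero:
  assumes "n \<le> length ls" "x < length e" "0 < e ! x" "chain_emb e ls n ! x = 0"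
  shows "\<exists>t<n. ls ! t = x \<and> chain_emb e ls t ! x = 1 \<and> chain_emb e ls (Suc t) ! x = 0"
proof -
  define s where "s = (LEAST s. chain_emb e ls s ! x = 0)"
  have s: "chain_emb e ls s ! x = 0" "s \<le> n"
    unfolding s_def using assms(4) by (auto intro: LeastI Least_le)
  then have "s \<noteq> 0" using assms(3) by (auto intro: ccontr)
  then obtain t where t: "s = Suc t" by (cases s) auto
  have nz: "chain_emb e ls t ! x \<noteq> 0" 
    using t not_less_Least[of t "\<lambda>s. chain_emb e ls s ! x = 0"] unfolding s_def by auto
  have "chain_emb e ls (Suc t) = emb_reduce (chain_emb e ls t) (ls ! t)"
    using s t assms(1) by (simp add: chain_emb_Suc)
  then have "ls ! t = x \<and> chain_emb e ls t ! x = 1"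
    using s(1) nz assms(2) t by (auto simp: nth_emb_reduce split: if_splits)
  then show ?thesis using s t by (intro exI[of _ t]) auto
qed

lemma contiguous_between:
  assumes "contiguous e" "x < y" "y < z" "z < length e" "e ! x \<noteq> 0" "e ! z \<noteq> 0"
  shows "e ! y \<noteq> 0"
proof -
  obtain a m where s: "\<And>x. x < length e \<Longrightarrow> e ! x \<noteq> 0 \<longleftrightarrow> a \<le> x \<and> x < a + m"
    using assms(1) by (auto simp: contiguous_def supported_def)
  show ?thesis using s[of x] s[of y] s[of z] assms by auto
qed

text \<open>Lowering \<open>k\<close> makes \<open>l\<close> reducible only by turning it into the
  last letter. So \<open>l\<close> carries a one directly before \<open>k\<close>, which carried the
  last one, and the word in between is non-flat.\<close>

lemma rigid_descent:
  assumes "contiguous e" "reducible e k" "reducible (emb_reduce e k) l" "l < k" "\<not> reducible e l"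
  shows "k = Suc l" "e ! k = 1" "e ! l = 1" "\<not> flat (word_of (emb_reduce e k))"
    and "\<And>x. k < x \<Longrightarrow> x < length e \<Longrightarrow> e ! x = 0"
proof -
  have k: "k < length e" "e ! k \<ge> 1" using reducible_bounds[OF assms(2)] by auto
  have el: "emb_reduce e k ! l = e ! l" using k assms(4) by (simp add: nth_emb_reduce)
  have l: "e ! l \<ge> 1" using reducible_bounds[OF assms(3)] el by simp
  have "\<not> e ! l > 1" using reducible_big[of l e] assms(4,5) k by auto
  with l show l1: "e ! l = 1" by simp
  have "\<not> (\<forall>i<l. emb_reduce e k ! i = 0)"
  proof
    assume "\<forall>i<l. emb_reduce e k ! i = 0"
    then have "\<forall>i<l. e ! i = 0" using k assms(4) by (auto simp: nth_emb_reduce)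
    then show False using reducible_first[of l e] l assms(4,5) k by auto
  qed
  then have last: "\<not> flat (word_of (emb_reduce e k))"
    "\<And>i. l < i \<Longrightarrow> i < length e \<Longrightarrow> emb_reduce e k ! i = 0"
    using assms(3) l1 el unfolding reducible_def emb_reducible_def by auto
  then show "\<not> flat (word_of (emb_reduce e k))" by simp
  show k1: "e ! k = 1" using last(2)[of k] k assms(4) by (simp add: nth_emb_reduce)
  show "e ! x = 0" if "k < x" "x < length e" for x
    using last(2)[of x] that assms(4) by (simp add: nth_emb_reduce)
  show "k = Suc l"
  proof (rule ccontr)
    assume "k \<noteq> Suc l"
    then have "Suc l < k" using assms(4) by simp
    then have "e ! Suc l = 0" using last(2)[of "Suc l"] k by (simp add: nth_emb_reduce)
    then show False
      using contiguous_between[OF assms(1), of l "Suc l" k] \<open>Suc l < k\<close> k l1 by auto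
  qed
qed

text \<open>In a full word the two ones just found are the last two letters, so this is precisely a
  descent that is not strong.\<close>

lemma rigid_descent_word:
  assumes "w \<in> Pstar" "reducible w k" "reducible (emb_reduce w k) l" "l < k" "\<not> reducible w l"
  shows "w = word_of (emb_reduce (emb_reduce w k) l) @ [1, 1]"
proof -
  note r = rigid_descent[OF contiguous_Pstar[OF assms(1)] assms(2-)]
  have k: "k < length w" using reducible_bounds[OF assms(2)] by auto
  have pos: "\<And>x. x < length w \<Longrightarrow> w ! x \<noteq> 0" using assms(1) by (auto simp: Pstar_iff)
  have len: "length w = Suc (Suc l)"
    using r(5)[of "Suc k"] pos[of "Suc k"] k r(1) by (metis lessI not_less_eq Suc_lessI)
  have eq: "w = take l w @ [1, 1]"
    using len r(1-3) by (intro nth_equalityI) (auto simp: nth_append nth_Cons' less_Suc_eq)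
  have t: "take l w \<in> Pstar" using assms(1) by (auto simp: Pstar_iff)
  have "emb_reduce (emb_reduce w k) l = replicate 0 0 @ take l w @ replicate 2 0"
    using len r(1-3) by (intro nth_equalityI)
      (auto simp: nth_append nth_emb_reduce less_Suc_eq numeral_2_eq_2)
  then have "word_of (emb_reduce (emb_reduce w k) l) = take l w"
    using word_of_padded[of 0 "take l w" 2] word_of_id[OF t] by simp
  then show ?thesis using eq by simp
qed

lemma length_word_of_reduce:
  assumes "contiguous e" "reducible e k"
  shows "length (word_of e) \<le> Suc (length (word_of (emb_reduce e k)))"
    and "e ! k > 1 \<Longrightarrow> length (word_of (emb_reduce e k)) = length (word_of e)"
proof -
  obtain a m where s: "supported e a m" using assms(1) by (auto simp: contiguous_def)
  note w = word_of_supported(2)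
  from s assms(2) show "length (word_of e) \<le> Suc (length (word_of (emb_reduce e k)))"
    by (cases rule: reducible_cases) (auto simp: w[OF s] dest!: w)
  from s assms(2) show "e ! k > 1 \<Longrightarrow> length (word_of (emb_reduce e k)) = length (word_of e)"
    by (cases rule: reducible_cases) (auto simp: w[OF s] dest!: w)
qed

text \<open>If \<open>w\<close> were \<open>u @ [1, 1]\<close>, both steps would delete a letter,
  \<open>k\<close> the last and \<open>l\<close> the first. Then \<open>u\<close> is an initial
  piece of \<open>w\<close> and also \<open>w\<close> stripped at both ends, so each letter equals
  the next and \<open>w\<close> is all ones; but deleting the last letter required a non-flat
  \<open>w\<close>.\<close>

lemma swappable_descent_word:
  assumes "w \<in> Pstar" "reducible w k" "reducible (emb_reduce w k) l" "l < k" "reducible w l"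
  shows "w \<noteq> word_of (emb_reduce (emb_reduce w k) l) @ [1, 1]"
proof
  define u where "u = word_of (emb_reduce (emb_reduce w k) l)"
  assume "w = word_of (emb_reduce (emb_reduce w k) l) @ [1, 1]"
  then have w: "w = u @ [1, 1]" by (simp add: u_def)
  have con: "contiguous w" "contiguous (emb_reduce w k)"
    using contiguous_Pstar[OF assms(1)] contiguous_reduce assms(2) by auto
  have k: "k < length w" using reducible_bounds[OF assms(2)] by auto
  have s: "supported w 0 (length w)" using supported_Pstar[OF assms(1)] .
  have ww: "length (word_of w) = length w" using word_of_id[OF assms(1)] by simp
  have lw: "length w = Suc (Suc (length u))" by (subst w) simp
  have "\<not> w ! k > 1"
    using length_word_of_reduce[OF con(1) assms(2)] length_word_of_reduce[OF con(2) assms(3)]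
      ww lw by (auto simp: u_def)
  then have kl: "w ! k = 1" "Suc k = length w" "\<not> flat w"
    using reducible_cases[OF s assms(2)] assms(4) word_of_id[OF assms(1)]
    by (metis One_nat_def Suc_diff_1 add_0 bot_nat_0.extremum_strict length_greater_0_conv
        less_zeroE list.size(3) gr_zeroI)+
  have "\<not> emb_reduce w k ! l > 1"
    using length_word_of_reduce[OF con(1) assms(2)] length_word_of_reduce[OF con(2) assms(3)]
      ww lw by (auto simp: u_def)
  then have "\<not> w ! l > 1" using assms(4) k by (simp add: nth_emb_reduce)
  then have l: "l = 0" "w ! 0 = 1"
    using reducible_cases[OF s assms(5)] assms(4) kl(2)
    by (metis One_nat_def add_0 diff_Suc_1 nat_neq_iff)+
  have "emb_reduce (emb_reduce w k) l = replicate 1 0 @ take (length u) (drop 1 w) @ replicate 1 0"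
    using kl l lw assms(4) by (intro nth_equalityI)
      (auto simp: nth_append nth_emb_reduce nth_Cons' less_Suc_eq)
  moreover have "take (length u) (drop 1 w) \<in> Pstar"
    using assms(1) lw by (auto simp: Pstar_iff)
  ultimately have u: "u = take (length u) (drop 1 w)"
    unfolding u_def using word_of_padded[of 1 _ 1] word_of_id by metis
  have "w ! y = 1" if "y \<le> length u" for y
    using that
  proof (induction y)
    case (Suc y)
    have "w ! Suc y = take (length u) (drop 1 w) ! y" using Suc.prems lw by simp
    also have "\<dots> = u ! y" using u by simp
    also have "\<dots> = w ! y" using Suc.prems w by (metis Suc_le_eq nth_append)
    finally show ?case using Suc by simp
  qed (use l in simp)
  then have "\<forall>y<length w. w ! y = 1" using kl lw by (auto simp: less_Suc_eq_le le_Suc_eq)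
  then show False using kl(3) by (auto simp: flat_def in_set_conv_nth)
qed

section \<open>Chains without swappable descents\<close>

definition swap_free :: "nat list \<Rightarrow> nat list \<Rightarrow> bool" where
  "swap_free e ls \<longleftrightarrow> (\<forall>k. Suc k < length ls \<and> ls ! Suc k < ls ! k \<longrightarrow>
     \<not> reducible (chain_emb e ls k) (ls ! Suc k))"

text \<open>The comparison is with the final embedding, not the final word: a competitor must end at
  the very same occurrence. For non-flat final words this is the run form of being the first
  admissible chain.\<close>

definition greedy :: "nat list \<Rightarrow> nat list \<Rightarrow> bool" where
  "greedy e ls \<longleftrightarrow> (\<forall>k<length ls. \<forall>l<ls ! k. reducible (chain_emb e ls k) l \<longrightarrow>
     \<not> list_all2 (\<le>) (chain_emb e ls (length ls)) (emb_reduce (chain_emb e ls k) l))"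

lemma le_swapped:
  assumes "Suc k < length ls" "ls ! Suc k \<noteq> ls ! k" "run e ls"
  shows "list_all2 (\<le>) (chain_emb e ls (Suc (Suc k))) (emb_reduce (chain_emb e ls k) (ls ! Suc k))"
  using assms by (auto simp: list_all2_conv_all_nth chain_emb_Suc nth_emb_reduce)

lemma list_all2_le_trans:
  "list_all2 (\<le>) xs ys \<Longrightarrow> list_all2 (\<le>) ys zs \<Longrightarrow> list_all2 (\<le>) xs (zs :: nat list)"
  unfolding list_all2_conv_all_nth by (metis order_trans)

text \<open>Swapping a descent uses a smaller position and leads to the same embedding two steps
  later.\<close>

lemma greedy_imp_swap_free:
  assumes "run e ls" "greedy e ls"
  shows "swap_free e ls"
  unfolding swap_free_def
proof (intro allI impI)
  fix k assume k: "Suc k < length ls \<and> ls ! Suc k < ls ! k"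
  then have "list_all2 (\<le>) (chain_emb e ls (length ls)) (chain_emb e ls (Suc (Suc k)))"
    by (intro chain_emb_antimono) auto
  then have "list_all2 (\<le>) (chain_emb e ls (length ls)) (emb_reduce (chain_emb e ls k) (ls ! Suc k))"
    using le_swapped[of k ls e] k assms(1) list_all2_le_trans by auto
  then show "\<not> reducible (chain_emb e ls k) (ls ! Suc k)"
    using assms(2) k unfolding greedy_def by (metis Suc_lessD)
qed

text \<open>This is \<open>rigid_descent\<close> inside a run. The third claim concerns the word
  between the two steps; \<open>swap_free_not_below_first\<close> derives its contradiction from
  it.\<close>

lemma swap_free_descent:
  assumes "contiguous e" "run e ls" "swap_free e ls" "Suc k < length ls" "ls ! Suc k < ls ! k"
  shows "ls ! k = Suc (ls ! Suc k)" "chain_emb e ls k ! (ls ! Suc k) = 1"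
    "\<not> flat (word_of (chain_emb e ls (Suc k)))"
    "\<And>x. ls ! k < x \<Longrightarrow> x < length e \<Longrightarrow> chain_emb e ls k ! x = 0"
    "chain_emb e ls (Suc (Suc k)) ! (ls ! Suc k) = 0"
proof -
  have c: "contiguous (chain_emb e ls k)" using contiguous_chain_emb[OF assms(1,2)] assms(4) by simp
  have r: "reducible (chain_emb e ls k) (ls ! k)"
    "reducible (emb_reduce (chain_emb e ls k) (ls ! k)) (ls ! Suc k)"
    using assms(2,4) unfolding run_nth by (auto simp: chain_emb_Suc[symmetric])
  have n: "\<not> reducible (chain_emb e ls k) (ls ! Suc k)"
    using assms(3-5) by (auto simp: swap_free_def)
  note rd = rigid_descent[OF c r assms(5) n]
  show "ls ! k = Suc (ls ! Suc k)" "chain_emb e ls k ! (ls ! Suc k) = 1"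
    "\<And>x. ls ! k < x \<Longrightarrow> x < length e \<Longrightarrow> chain_emb e ls k ! x = 0" using rd by auto
  show "\<not> flat (word_of (chain_emb e ls (Suc k)))" using rd assms(4) by (simp add: chain_emb_Suc)
  have "ls ! k < length e" using reducible_bounds(1)[OF r(1)] by simp
  then show "chain_emb e ls (Suc (Suc k)) ! (ls ! Suc k) = 0"
    using rd(3) assms(4,5) by (simp add: chain_emb_Suc nth_emb_reduce)
qed

text \<open>Otherwise there is a first step at a position at most \<open>l\<close>. Together with
  the step before it this is a descent, hence rigid, so it deletes \<open>l\<close> itself as a
  trailing one. Thus \<open>w ! l = 1\<close>, and since \<open>l\<close> is reducible in
  \<open>w\<close> without being its last position, \<open>l = 0\<close>. The embedding before the
  descent is then \<open>1, 1, 0, ...\<close>, so the word in between is flat, which rigidity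
  forbids.\<close>

lemma swap_free_not_below_first:
  assumes "w \<in> Pstar" "run w ls" "swap_free w ls" "l < ls ! 0" "reducible w l" "ls \<noteq> []"
  shows "\<not> list_all2 (\<le>) (chain_emb w ls (length ls)) (emb_reduce w l)"
proof
  assume le: "list_all2 (\<le>) (chain_emb w ls (length ls)) (emb_reduce w l)"
  note con = contiguous_Pstar[OF assms(1)]
  have l: "l < length w" "w ! l \<ge> 1" using reducible_bounds[OF assms(5)] by auto
  have lt: "chain_emb w ls (length ls) ! l < w ! l"
    using le l by (auto simp: list_all2_conv_all_nth nth_emb_reduce dest!: spec[of _ l])
  have "\<exists>t. t < length ls \<and> ls ! t \<le> l"
    using chain_emb_unchanged[of 0 "length ls" ls l w] lt l by fastforce
  then obtain t where t: "t < length ls" "ls ! t \<le> l"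
    "\<And>s. s < t \<Longrightarrow> \<not> (s < length ls \<and> ls ! s \<le> l)"
    using LeastI_ex[of "\<lambda>t. t < length ls \<and> ls ! t \<le> l"]
      not_less_Least[of _ "\<lambda>t. t < length ls \<and> ls ! t \<le> l"] by blast
  have "t \<noteq> 0" using t(2) assms(4) by (auto intro: ccontr)
  then obtain s where s: "t = Suc s" by (cases t) auto
  then have d: "Suc s < length ls" "ls ! Suc s < ls ! s" using t(1,2) t(3)[of s] by auto
  note sd = swap_free_descent[OF con assms(2,3) d]
  have lt: "ls ! t = l" using sd(1) s t(2) t(3)[of s] t(1) by auto
  have "ls ! r \<noteq> l" if "r < s" for r using t(3)[of r] that s t(1) by auto
  then have "chain_emb w ls s ! l = w ! l"
    using chain_emb_unchanged[of 0 s ls l w] t(1) s l by simp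
  then have w1: "w ! l = 1" using sd(2) lt s by simp
  have "ls ! 0 < length w"
    using assms(2,6) reducible_bounds(1)[of w "ls ! 0"] by (cases ls) auto
  from supported_Pstar[OF assms(1)] assms(5) have "l = 0"
    by (cases rule: reducible_cases) (use w1 assms(4) \<open>ls ! 0 < length w\<close> in auto)
  have "chain_emb w ls t ! x \<le> 1" if "x < length w" for x
  proof (cases "x = 0")
    case True
    then show ?thesis using chain_emb_le[of 0 t ls x w] that t(1) w1 \<open>l = 0\<close> by simp
  next
    case False
    have "ls ! s = Suc 0" using sd(1) lt s \<open>l = 0\<close> by simp
    have k: "chain_emb w ls s ! (ls ! s) = 1"
      using rigid_descent(2)[OF contiguous_chain_emb[OF con assms(2)], of s "ls ! s" "ls ! Suc s"]
        assms(2,3) d by (auto simp: run_nth swap_free_def chain_emb_Suc[symmetric])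
    show ?thesis
      using sd(4)[of x] False that k \<open>ls ! s = Suc 0\<close> s t(1) chain_emb_le[of s t ls x w]
      by (cases "x = 1") auto
  qed
  then have "flat (word_of (chain_emb w ls t))" by (simp add: flat_word_of)
  then show False using sd(3) s by simp
qed

text \<open>Once position \<open>length u\<close> is zero, contiguity leaves only positions inside
  \<open>u\<close>; a further step would be a descent, hence rigid, and would delete a letter of
  \<open>u\<close>. So that step is the last one, and as it deletes a one that is not in front, the
  word is non-flat. The second claim is stated for any \<open>t\<close> because it is later applied
  to the very first step.\<close>

lemma swap_free_last_step:
  assumes "w \<in> Pstar" "run w ls" "swap_free w ls"
    and "u \<in> Pstar" "u \<noteq> []" "length u < length w"
    and fin: "chain_emb w ls (length ls) = prefix_embedding u w"
  shows "\<exists>n. length ls = Suc n \<and> ls ! n = length u \<and>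
      chain_emb w ls n = prefix_embedding (u @ [1]) w \<and> \<not> flat u"
    and "\<And>t. t < length ls \<Longrightarrow> ls ! t = length u \<Longrightarrow> chain_emb w ls (Suc t) ! length u = 0 \<Longrightarrow>
      Suc t = length ls"
proof -
  note con = contiguous_Pstar[OF assms(1)]
  have fin_nth: "chain_emb w ls (length ls) ! x = (if x < length u then u ! x else 0)"
    if "x < length w" for x
    using that fin by (simp add: prefix_embedding_def nth_append)
  have upos: "\<And>x. x < length u \<Longrightarrow> u ! x \<ge> 1" using assms(4) by (simp add: Pstar_iff)
  have pos: "chain_emb w ls s ! x \<noteq> 0" if "s \<le> length ls" "x < length u" for s x
    using chain_emb_le[of s "length ls" ls x w] that fin_nth[of x] upos[of x] assms(6) by auto
  show last: "Suc t = length ls"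
    if t: "t < length ls" "ls ! t = length u" "chain_emb w ls (Suc t) ! length u = 0" for t
  proof (rule ccontr)
    assume "Suc t \<noteq> length ls"
    then have st: "Suc t < length ls" using t by simp
    have cs: "contiguous (chain_emb w ls (Suc t))"
      using contiguous_chain_emb[OF con assms(2)] st by simp
    have "reducible (chain_emb w ls (Suc t)) (ls ! Suc t)" using assms(2) st by (simp add: run_nth)
    note rb = reducible_bounds[OF this]
    have "ls ! Suc t < length u"
    proof (rule ccontr)
      assume "\<not> ls ! Suc t < length u"
      then consider "ls ! Suc t = length u" | "ls ! Suc t > length u" by linarith
      then show False
      proof cases
        case 1
        then show ?thesis using rb t by simp
      next
        case 2
        then show ?thesis
          using contiguous_between[OF cs, of 0 "length u" "ls ! Suc t"] rb t pos[of "Suc t" 0] st assms(5)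
          by auto
      qed
    qed
    then have d: "ls ! Suc t < ls ! t" using t by simp
    show False
      using swap_free_descent[OF con assms(2,3) st d] pos[of "Suc (Suc t)" "ls ! Suc t"] st
        \<open>ls ! Suc t < length u\<close> by simp
  qed
  have "w ! length u > 0" using assms(1,6) by (auto simp: Pstar_iff Suc_le_eq)
  then obtain t where t: "t < length ls" "ls ! t = length u" "chain_emb w ls t ! length u = 1"
      "chain_emb w ls (Suc t) ! length u = 0"
    using step_dropping_to_zero[of "length ls" ls "length u" w] fin_nth[of "length u"] assms(6) by auto
  have n: "length ls = Suc t" using last[OF t(1,2,4)] by simp
  have E: "chain_emb w ls (length ls) = emb_reduce (chain_emb w ls t) (length u)"
    using n t by (simp add: chain_emb_Suc)
  have eq: "chain_emb w ls t = prefix_embedding (u @ [1]) w"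
  proof (intro nth_equalityI)
    show "length (chain_emb w ls t) = length (prefix_embedding (u @ [1]) w)"
      using assms(6) by (simp add: prefix_embedding_def)
    fix x assume "x < length (chain_emb w ls t)"
    then have x: "x < length w" by simp
    have "emb_reduce (chain_emb w ls t) (length u) ! x = (if x < length u then u ! x else 0)"
      using E fin_nth[OF x] by simp
    then show "chain_emb w ls t ! x = prefix_embedding (u @ [1]) w ! x"
      using t(3) x by (auto simp: prefix_embedding_def nth_append nth_emb_reduce split: if_splits)
  qed
  have "reducible (chain_emb w ls t) (length u)" using assms(2) t by (auto simp: run_nth)
  moreover have "\<not> (\<forall>i<length u. chain_emb w ls t ! i = 0)" using pos[of t 0] t assms(5) by auto
  ultimately have nf: "\<not> flat (word_of (chain_emb w ls t))"
    using t(3) unfolding reducible_def emb_reducible_def by auto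
  have "u @ [1] \<in> Pstar" using assms(4) by (auto simp: Pstar_def)
  then have "word_of (chain_emb w ls t) = u @ [1]"
    using word_of_padded[of 0 "u @ [1]"] word_of_id unfolding eq prefix_embedding_def by simp
  then have "\<not> flat u" using nf by (auto simp: flat_def)
  then show "\<exists>n. length ls = Suc n \<and> ls ! n = length u \<and>
      chain_emb w ls n = prefix_embedding (u @ [1]) w \<and> \<not> flat u"
    using n t eq by (intro exI[of _ t]) simp
qed

section \<open>Principal factors\<close>

lemma is_prefix_iff: "is_prefix p w \<longleftrightarrow> occurs_at p 0 w"
  by (simp add: is_prefix_def occurs_at_def)

lemma is_suffix_iff: "is_suffix p w \<longleftrightarrow> length p \<le> length w \<and> occurs_at p (length w - length p) w"
  by (auto simp: is_suffix_def occurs_at_def)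

text \<open>Overlapping the word with itself, shifted by an inner occurrence of the factor, produces a
  longer outer factor; so maximality means that there is no inner occurrence.\<close>

lemma maximal_outer_factor_iff:
  assumes "w \<in> Pstar" "p \<in> Pstar"
  shows "maximal_outer_factor p w \<longleftrightarrow> length p < length w \<and> occurs_at p 0 w \<and>
    occurs_at p (length w - length p) w \<and>
    (\<forall>c. 0 < c \<and> c + length p < length w \<longrightarrow> \<not> occurs_at p c w)"
proof -
  have out: "outer_factor q w \<longleftrightarrow> q \<in> Pstar \<and> length q < length w \<and> occurs_at q 0 w \<and>
    occurs_at q (length w - length q) w" for q
    by (auto simp: outer_factor_def is_prefix_iff is_suffix_iff)
  have "(\<exists>q. outer_factor q w \<and> length p < length q \<and> gfo_le p q) \<longleftrightarrow>
    (\<exists>c. 0 < c \<and> c + length p < length w \<and> occurs_at p c w)" if p0: "occurs_at p 0 w"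
  proof
    assume "\<exists>q. outer_factor q w \<and> length p < length q \<and> gfo_le p q"
    then obtain q d where q: "length q < length w" "occurs_at q 0 w"
      "occurs_at q (length w - length q) w" "length p < length q" "occurs_at p d q"
      by (auto simp: out gfo_le_iff)
    have comp: "occurs_at p (c + d) w" if "occurs_at q c w" for c
      using q(5) that unfolding occurs_at_def
      by (auto simp: add.assoc intro: order_trans[of _ "q ! (d + _)"])
    show "\<exists>c. 0 < c \<and> c + length p < length w \<and> occurs_at p c w"
    proof (cases "d = 0")
      case True
      then show ?thesis using comp[OF q(3)] q by (intro exI[of _ "length w - length q"]) auto
    next
      case False
      then show ?thesis using comp[OF q(2)] q by (intro exI[of _ d]) (auto simp: occurs_at_def)
    qed
  next
    assume "\<exists>c. 0 < c \<and> c + length p < length w \<and> occurs_at p c w"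
    then obtain c where c: "0 < c" "c + length p < length w" "occurs_at p c w" by auto
    define q where "q = map (\<lambda>i. min (w ! i) (w ! (c + i))) [0..<length w - c]"
    have len: "length q = length w - c" by (simp add: q_def)
    have nth: "q ! i = min (w ! i) (w ! (c + i))" if "i < length w - c" for i
      using that by (simp add: q_def)
    have "q \<in> Pstar" using assms(1) len nth by (auto simp: Pstar_iff)
    moreover have "occurs_at q 0 w" using len nth by (auto simp: occurs_at_def)
    moreover have "occurs_at q (length w - length q) w"
      using len nth c by (auto simp: occurs_at_def)
    moreover have "occurs_at p 0 q" using p0 c len nth by (auto simp: occurs_at_def)
    ultimately show "\<exists>q. outer_factor q w \<and> length p < length q \<and> gfo_le p q"
      using c len by (intro exI[of _ q]) (auto simp: out gfo_le_iff)
  qed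
  then show ?thesis unfolding maximal_outer_factor_def using out[of p] assms(2) by blast
qed

lemma word_reducible_iff:
  assumes "w \<in> Pstar"
  shows "word_reducible w k \<longleftrightarrow> reducible w k"
proof
  assume "word_reducible w k"
  then consider "k < length w" "w ! k > 1" | "k < length w" "w ! k = 1" "k = 0"
    | "k < length w" "w ! k = 1" "k = length w - 1" "\<not> flat w"
    by (auto simp: word_reducible_def)
  then show "reducible w k"
  proof cases
    case 3
    then show ?thesis using word_of_id[OF assms] by (intro reducible_last) auto
  qed (auto intro: reducible_big reducible_first)
next
  assume "reducible w k"
  with supported_Pstar[OF assms] show "word_reducible w k"
    using word_of_id[OF assms] by (cases rule: reducible_cases) (auto simp: word_reducible_def)
qed

lemma word_reduce_eq: "word_reduce w k = word_of (emb_reduce w k)"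
  by (simp add: word_reduce_def word_of_def emb_reduce_def)

text \<open>The prefix embedding is \<open>u\<close> followed by zeros, so the inequality in the
  principal index says that lowering this letter stays above the final embedding. By
  \<open>nb\<close> no position before the first step does.\<close>

lemma principal_index_first:
  assumes "w \<in> Pstar" "run w ls" "ls \<noteq> []" "length u < length w"
    and fin: "chain_emb w ls (length ls) = prefix_embedding u w"
    and nb: "\<And>l. l < ls ! 0 \<Longrightarrow> reducible w l \<Longrightarrow>
      \<not> list_all2 (\<le>) (chain_emb w ls (length ls)) (emb_reduce w l)"
  shows "principal_index u w = ls ! 0"
  unfolding principal_index_def
proof (rule Least_equality)
  have fin_nth: "(if x < length u then u ! x else 0) = chain_emb w ls (length ls) ! x"
    if "x < length w" for x
    using that fin by (simp add: prefix_embedding_def nth_append)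
  have r: "reducible w (ls ! 0)" using assms(2,3) by (cases ls) auto
  have E1: "chain_emb w ls (Suc 0) = emb_reduce w (ls ! 0)" using assms(3) by (simp add: chain_emb_Suc)
  note rb = reducible_bounds[OF r]
  have "chain_emb w ls (length ls) ! (ls ! 0) \<le> chain_emb w ls (Suc 0) ! (ls ! 0)"
    using assms(3) rb(1) by (intro chain_emb_le) (auto simp: Suc_le_eq)
  then have "chain_emb w ls (length ls) ! (ls ! 0) < w ! (ls ! 0)"
    using rb by (simp add: E1 nth_emb_reduce)
  then show "word_reducible w (ls ! 0) \<and>
      (if ls ! 0 < length u then u ! (ls ! 0) else 0) < w ! (ls ! 0)"
    using r rb fin_nth assms(1) by (simp add: word_reducible_iff)
  fix l assume l: "word_reducible w l \<and> (if l < length u then u ! l else 0) < w ! l"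
  then have lr: "reducible w l" "l < length w" using assms(1) by (auto simp: word_reducible_iff reducible_bounds)
  then have "list_all2 (\<le>) (chain_emb w ls (length ls)) (emb_reduce w l)"
    using l fin_nth[of l] chain_emb_le[of 0 "length ls" ls _ w]
    by (auto simp: list_all2_conv_all_nth nth_emb_reduce)
  then show "ls ! 0 \<le> l" using nb lr by (metis not_le)
qed

lemma occurs_prefix_embedding:
  assumes "length u \<le> length w" "length e = length w"
  shows "list_all2 (\<le>) (prefix_embedding u w) e \<longleftrightarrow> occurs_at u 0 e"
  using assms by (auto simp: list_all2_conv_all_nth prefix_embedding_def occurs_at_def nth_append)

lemma prefix_embedding_props:
  assumes "u \<in> Pstar" "length u \<le> length w"
  shows "word_of (prefix_embedding u w) = u" "supported (prefix_embedding u w) 0 (length u)"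
  using word_of_padded[of 0 u] supported_padded[OF assms(1), of 0] word_of_id[OF assms(1)] assms
  by (simp_all add: prefix_embedding_def)

section \<open>Minimality for a chain starting at a full word\<close>

lemma run_first_two:
  assumes "run e ls" "2 \<le> length ls"
  shows "reducible e (ls ! 0)" "reducible (emb_reduce e (ls ! 0)) (ls ! 1)"
  using assms by (cases ls; cases "tl ls"; auto)+

text \<open>The assumptions spell out minimality: \<open>c1\<close> is an improvement at the first
  step, \<open>c2\<close> says that it is lost when the bottom word is dropped, and
  \<open>c3\<close> that no later step can be improved.\<close>

lemma minimal_improvable_imp:
  fixes w ls :: "nat list"
  defines "n \<equiv> length ls" and "E \<equiv> chain_emb w ls"
  defines "u \<equiv> word_of (E n)"
  assumes "w \<in> Pstar" "run w ls" "2 \<le> n"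
    and c1: "\<exists>l<ls ! 0. reducible w l \<and> gfo_le u (emb_reduce w l)"
    and c2: "\<And>l. l < ls ! 0 \<Longrightarrow> reducible w l \<Longrightarrow> \<not> gfo_le (word_of (E (n - 1))) (emb_reduce w l)"
    and c3: "\<And>k l. 0 < k \<Longrightarrow> k < n \<Longrightarrow> l < ls ! k \<Longrightarrow> reducible (E k) l \<Longrightarrow>
      \<not> gfo_le u (emb_reduce (E k) l)"
  shows "n = 2 \<and> ls ! 1 < ls ! 0 \<and> w \<noteq> u @ [1, 1] \<or>
    principal_factor u w \<and> ls ! 0 = principal_index u w \<and> E n = prefix_embedding u w \<and> greedy w ls"
proof (cases "swap_free w ls")
  case False
  note con = contiguous_Pstar[OF assms(4)]
  obtain k where k: "Suc k < n" "ls ! Suc k < ls ! k" "reducible (E k) (ls ! Suc k)"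
    using False by (auto simp: swap_free_def n_def E_def)
  have le: "gfo_le (word_of (E m)) (emb_reduce (E k) (ls ! Suc k))" if "Suc (Suc k) \<le> m" "m \<le> n" for m
    using gfo_le_chain_emb[OF con assms(5) that[unfolded n_def]] le_swapped[of k ls w] k assms(5)
    by (auto simp: n_def E_def intro: gfo_le_mono)
  \<comment> \<open>The swap stays above every word from two steps later on; so \<open>c3\<close>
    places it at the start, and \<open>c2\<close> leaves nothing below it.\<close>
  have "k = 0" using c3[of k "ls ! Suc k"] le[of n] k by (auto simp: u_def)
  have "n = 2"
  proof (rule ccontr)
    assume "n \<noteq> 2"
    then show False using c2[of "ls ! Suc 0"] le[of "n - 1"] k \<open>k = 0\<close> assms(6) by (auto simp: E_def)
  qed
  have "reducible w (ls ! 0)" "reducible (emb_reduce w (ls ! 0)) (ls ! 1)"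
    using run_first_two[OF assms(5)] assms(6) by (auto simp: n_def)
  moreover have "u = word_of (emb_reduce (emb_reduce w (ls ! 0)) (ls ! 1))"
    using \<open>n = 2\<close> by (simp add: u_def E_def n_def numeral_2_eq_2 chain_emb_Suc)
  ultimately have "w \<noteq> u @ [1, 1]"
    using swappable_descent_word[OF assms(4)] k \<open>k = 0\<close> by (simp add: E_def)
  then show ?thesis using \<open>n = 2\<close> k \<open>k = 0\<close> by simp
next
  case sf: True
  note con = contiguous_Pstar[OF assms(4)]
  have ls: "ls \<noteq> []" using assms(6) by (auto simp: n_def)
  have nb: "\<not> list_all2 (\<le>) (E n) (emb_reduce w l)" if "l < ls ! 0" "reducible w l" for l
    using swap_free_not_below_first[OF assms(4,5) sf that ls] by (simp add: E_def n_def)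
  have u: "u \<in> Pstar" by (simp add: u_def word_of_Pstar)
  obtain l b where l: "l < ls ! 0" "reducible w l" "occurs_at u b (emb_reduce w l)"
    using c1 by (auto simp: gfo_le_iff)
  note lb = reducible_bounds[OF l(2)]
  have "0 < length w" using lb(1) by linarith
  then have r0: "reducible w 0" using assms(4) by (intro reducible_first) (auto simp: Pstar_iff)
  have l0: "0 < ls ! 0" using l by simp
  have Ew: "E n ! x \<le> w ! x" if "x < length w" for x
    using chain_emb_le[of 0 n ls x w] that by (simp add: E_def n_def)
  have lenE: "length (E k) = length w" for k by (simp add: E_def)
  obtain a m where s: "supported (E n) a m"
    using contiguous_chain_emb[OF con assms(5), of n] by (auto simp: contiguous_def E_def n_def)
  have m: "length u = m" using word_of_supported(2)[OF s] by (simp add: u_def)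
  \<comment> \<open>With a zero in front, position 0 would be a smaller position compatible with the
    final embedding.\<close>
  have z0: "E n ! 0 \<noteq> 0"
  proof
    assume "E n ! 0 = 0"
    then have "list_all2 (\<le>) (E n) (emb_reduce w 0)"
      using Ew lenE by (auto simp: list_all2_conv_all_nth nth_emb_reduce)
    then show False using nb[OF l0 r0] by simp
  qed
  have am: "a = 0" "0 < m" using s z0 lenE[of n] \<open>0 < length w\<close> by (auto simp: supported_def)
  have fin: "E n = prefix_embedding u w"
    using word_of_supported(1)[OF s] am m lenE by (simp add: prefix_embedding_def u_def)
  have une: "u \<noteq> []" using am m by auto
  have lenu: "b + length u \<le> length w" using l(3) by (simp add: occurs_at_def)
  have prefix: "list_all2 (\<le>) (E n) e \<longleftrightarrow> occurs_at u 0 e" if "length e = length w" for e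
    unfolding fin using occurs_prefix_embedding[OF _ that] lenu by simp
  \<comment> \<open>A prefix occurrence would make \<open>l\<close> compatible with the final
    embedding.\<close>
  have "b \<noteq> 0" using nb[OF l(1,2)] prefix l(3) by (auto intro: ccontr)
  then have lu: "length u < length w" using lenu by simp
  note last = swap_free_last_step[OF assms(4,5) sf u une lu fin[unfolded E_def n_def]]
  have En: "E (n - 1) = prefix_embedding (u @ [1]) w" and nf: "\<not> flat u"
    using last(1) by (auto simp: E_def n_def)
  have u1: "u @ [1] \<in> Pstar" using u by (auto simp: Pstar_def)
  have wn: "word_of (E (n - 1)) = u @ [1]"
    unfolding En using prefix_embedding_props(1)[OF u1] lu by simp
  have greedy: "greedy w ls"
    unfolding greedy_def
  proof (intro allI impI)
    fix k l assume k: "k < length ls" "l < ls ! k" "reducible (chain_emb w ls k) l"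
    show "\<not> list_all2 (\<le>) (chain_emb w ls (length ls)) (emb_reduce (chain_emb w ls k) l)"
    proof (cases "k = 0")
      case True
      then show ?thesis using nb k by (simp add: E_def n_def)
    next
      case False
      then show ?thesis
        using c3[of k l] k prefix[of "emb_reduce (E k) l"] lenE by (auto simp: E_def n_def gfo_le_iff)
    qed
  qed
  have pi: "principal_index u w = ls ! 0"
    using principal_index_first[OF assms(4,5) ls lu] fin nb by (simp add: E_def n_def)
  \<comment> \<open>There is room for one more letter, so \<open>u\<close> extends to
    \<open>u @ [1]\<close>; as \<open>c > 0\<close>, lowering position 0 leaves this occurrence
    intact, against \<open>c2\<close>.\<close>
  have inner: "\<not> occurs_at u c w" if "0 < c" "c + length u < length w" for c
  proof
    assume o: "occurs_at u c w"
    have "occurs_at (u @ [1]) c (emb_reduce w 0)"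
      using o that assms(4) by (auto simp: occurs_at_def nth_append nth_emb_reduce Pstar_iff)
    then show False using c2[OF l0 r0] wn by (auto simp: gfo_le_iff)
  qed
  have "occurs_at u b w" using occurs_at_mono[OF l(3) emb_reduce_le] .
  then have suf: "occurs_at u (length w - length u) w"
    using inner[of b] \<open>b \<noteq> 0\<close> lenu by (metis add_diff_cancel_right' le_neq_implies_less neq0_conv)
  have "occurs_at u 0 w" using prefix[of w] Ew lenE by (auto simp: list_all2_conv_all_nth)
  then have mof: "maximal_outer_factor u w"
    using maximal_outer_factor_iff[OF assms(4) u] lu suf inner by blast
  have "\<not> is_suffix u (word_reduce w (ls ! 0))"
  proof
    assume "is_suffix u (word_reduce w (ls ! 0))"
    moreover have E1: "E 1 = emb_reduce w (ls ! 0)"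
      using ls by (simp add: E_def chain_emb_Suc)
    ultimately have su: "length u \<le> length (word_of (E 1))"
      "occurs_at u (length (word_of (E 1)) - length u) (word_of (E 1))"
      by (auto simp: word_reduce_eq is_suffix_iff)
    have r: "reducible w (ls ! 0)" "reducible (E 1) (ls ! 1)"
      using run_first_two[OF assms(5)] assms(6) E1 by (auto simp: n_def)
    have ww: "length (word_of w) = length w" using word_of_id[OF assms(4)] by simp
    \<comment> \<open>Position 0 being excluded, the first step either deletes nothing or deletes
      the last letter.\<close>
    from supported_Pstar[OF assms(4)] r(1)
    have "supported (E 1) 0 (length w) \<or> length w = Suc (ls ! 0) \<and> supported (E 1) 0 (ls ! 0)
        \<and> w ! (ls ! 0) = 1"
      by (cases rule: reducible_cases) (use l0 E1 in auto)
    \<comment> \<open>If more than \<open>length u\<close> letters are left, the suffix occurrence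
      avoids position 0, and \<open>c3\<close> forces the second step to be at 0. This descent is
      rigid and deletes the front letter, although \<open>E n\<close> still has it.\<close>
    moreover have far: False if s1: "supported (E 1) 0 M" and M: "length u < M" for M
    proof -
      have "length (word_of (E 1)) = M" using word_of_supported(2)[OF s1] .
      then have o1: "occurs_at u (M - length u) (E 1)"
        using su(2) occurs_at_word_of(1)[OF s1 u une] by simp
      have "E 1 ! 0 \<noteq> 0" using supported_pos[OF s1, of 0] M by simp
      have o2: "occurs_at u (M - length u) (emb_reduce (E 1) 0)"
        using o1 M by (auto simp: occurs_at_def nth_emb_reduce)
      have "reducible (E 1) 0" using \<open>E 1 ! 0 \<noteq> 0\<close> \<open>0 < length w\<close> lenE
        by (intro reducible_first) auto
      then have "ls ! 1 = 0" using c3[of 1 0] o2 assms(6) by (auto simp: gfo_le_iff)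
      then have d: "Suc 0 < length ls" "ls ! Suc 0 < ls ! 0" using assms(6) l0 by (auto simp: n_def)
      have "E 2 ! 0 = 0"
        using swap_free_descent(5)[OF con assms(5) sf d] \<open>ls ! 1 = 0\<close> by (simp add: E_def numeral_2_eq_2)
      then show False
        using chain_emb_le[of 2 n ls 0 w] assms(6) z0 \<open>0 < length w\<close> by (simp add: E_def n_def)
    qed
    ultimately show False
    proof (elim disjE conjE)
      show False if "supported (E 1) 0 (length w)" using far[OF that lu] .
      show False if h: "length w = Suc (ls ! 0)" "supported (E 1) 0 (ls ! 0)" "w ! (ls ! 0) = 1"
      proof (cases "length u < ls ! 0")
        case True
        then show ?thesis using far[OF h(2)] by simp
      next
        case False
        \<comment> \<open>Here the first step already deletes position \<open>length u\<close>, so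
          it would be the last one, whereas there are at least two.\<close>
        then have eq: "ls ! 0 = length u" using lu h(1) by simp
        have "E 1 ! length u = 0" using h eq E1 by (simp add: nth_emb_reduce)
        then show ?thesis using last(2)[of 0] eq ls assms(6) by (simp add: E_def n_def)
      qed
    qed
  qed
  then have "principal_factor u w" using mof nf pi by (simp add: principal_factor_def)
  then show ?thesis using pi fin greedy by simp
qed

text \<open>A competitor can use only two occurrences of \<open>u\<close>. Greediness blocks the
  prefix one at every step. The suffix one is destroyed by the first step, so it can serve only a
  competitor of that step: lowering position 0 does so, and this is the improvement.\<close>

lemma principal_imp_minimal:
  fixes w ls :: "nat list"
  defines "n \<equiv> length ls" and "E \<equiv> chain_emb w ls"
  defines "u \<equiv> word_of (E n)"
  assumes "w \<in> Pstar" "run w ls"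
    and pf: "principal_factor u w" and fin: "E n = prefix_embedding u w" and gr: "greedy w ls"
  shows "\<exists>l<ls ! 0. reducible w l \<and> gfo_le u (emb_reduce w l)"
    and "\<And>l. l < ls ! 0 \<Longrightarrow> reducible w l \<Longrightarrow> \<not> gfo_le (word_of (E (n - 1))) (emb_reduce w l)"
    and "\<And>k l. 0 < k \<Longrightarrow> k < n \<Longrightarrow> l < ls ! k \<Longrightarrow> reducible (E k) l \<Longrightarrow>
      \<not> gfo_le u (emb_reduce (E k) l)"
    and "ls \<noteq> []" and "principal_index u w = ls ! 0"
proof -
  note con = contiguous_Pstar[OF assms(4)]
  have u: "u \<in> Pstar" by (simp add: u_def word_of_Pstar)
  have nf: "\<not> flat u" and mof: "maximal_outer_factor u w"
    using pf by (auto simp: principal_factor_def)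
  then have une: "u \<noteq> []" by (auto simp: flat_def)
  have lu: "length u < length w" and suf: "occurs_at u (length w - length u) w"
    and inner: "\<And>c. 0 < c \<Longrightarrow> c + length u < length w \<Longrightarrow> \<not> occurs_at u c w"
    using mof maximal_outer_factor_iff[OF assms(4) u] by auto
  show ls: "ls \<noteq> []"
  proof
    assume "ls = []"
    then have "E n = w" by (simp add: E_def n_def)
    then have "u = w" using word_of_id[OF assms(4)] by (simp add: u_def)
    then show False using lu by simp
  qed
  have lenE: "length (E k) = length w" for k by (simp add: E_def)
  have prefix: "list_all2 (\<le>) (E n) e \<longleftrightarrow> occurs_at u 0 e" if "length e = length w" for e
    unfolding fin using occurs_prefix_embedding[OF _ that] lu by simp
  have nb: "\<not> occurs_at u 0 (emb_reduce (E k) l)" if "k < n" "l < ls ! k" "reducible (E k) l" for k l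
    using gr that prefix[of "emb_reduce (E k) l"] lenE by (auto simp: greedy_def E_def n_def)
  have n0: "0 < n" using ls by (simp add: n_def)
  show pi: "principal_index u w = ls ! 0"
    using principal_index_first[OF assms(4,5) ls lu] fin gr ls
    by (auto simp: E_def n_def greedy_def)
  have ns: "\<not> is_suffix u (word_reduce w (ls ! 0))"
    using pf pi by (simp add: principal_factor_def)
  have E1: "E 1 = emb_reduce w (ls ! 0)" using ls by (simp add: E_def chain_emb_Suc)
  have r: "reducible w (ls ! 0)" using assms(5) ls by (auto simp: run_nth dest: spec[of _ 0])
  \<comment> \<open>Lowering position 0 would keep the suffix occurrence, against
    principality.\<close>
  have pos: "0 < ls ! 0"
  proof (rule ccontr)
    assume "\<not> 0 < ls ! 0"
    then have l0: "ls ! 0 = 0" by simp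
    have o: "occurs_at u (length w - length u) (emb_reduce w 0)"
      using suf lu by (auto simp: occurs_at_def nth_emb_reduce)
    \<comment> \<open>Whether position 0 is lowered in place or deleted, the support still ends at
      \<open>length w\<close>, so suffixes keep their alignment.\<close>
    obtain a m where s: "supported (emb_reduce w 0) a m" "a + m = length w"
    proof -
      from supported_Pstar[OF assms(4)] r show ?thesis
        by (cases rule: reducible_cases) (use that l0 in auto)
    qed
    have c: "a \<le> length w - length u" using occurs_at_word_of(2)[OF s(1) u une o] .
    have len: "length (word_of (emb_reduce w 0)) = m" using word_of_supported(2)[OF s(1)] .
    have "length u \<le> m" "a + (m - length u) = length w - length u" using c s(2) lu by auto
    then have "is_suffix u (word_of (emb_reduce w 0))"
      unfolding is_suffix_iff len using occurs_at_word_of(1)[OF s(1) u une, of "m - length u"] o by simp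
    then show False using ns l0 by (simp add: word_reduce_eq)
  qed
  have "0 < length w" using lu by linarith
  then have r0: "reducible w 0" using assms(4) by (intro reducible_first) (auto simp: Pstar_iff)
  show "\<exists>l<ls ! 0. reducible w l \<and> gfo_le u (emb_reduce w l)"
  proof (intro exI conjI)
    show "0 < ls ! 0" "reducible w 0" using pos r0 by auto
    have "occurs_at u (length w - length u) (emb_reduce w 0)"
      using suf lu by (auto simp: occurs_at_def nth_emb_reduce)
    then show "gfo_le u (emb_reduce w 0)" by (auto simp: gfo_le_iff)
  qed
  have "E (n - 1) = prefix_embedding (u @ [1]) w"
    using swap_free_last_step(1)[OF assms(4,5) greedy_imp_swap_free[OF assms(5) gr] u une lu] fin
    by (auto simp: E_def n_def)
  then have wn: "word_of (E (n - 1)) = u @ [1]"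
    using prefix_embedding_props(1)[of "u @ [1]" w] lu u by (auto simp: Pstar_def)
  have split: "c = 0 \<or> c = length w - length u" if "occurs_at u c w" for c
  proof (cases "c = 0 \<or> c + length u < length w")
    case True
    then show ?thesis using inner[of c] that by auto
  next
    case False
    moreover have "c + length u \<le> length w" using that by (simp add: occurs_at_def)
    ultimately show ?thesis by linarith
  qed
  \<comment> \<open>An occurrence of \<open>u @ [1]\<close> contains one of \<open>u\<close> that is
    not the suffix, hence is the prefix, which greediness rules out.\<close>
  show "\<not> gfo_le (word_of (E (n - 1))) (emb_reduce w l)" if l: "l < ls ! 0" "reducible w l" for l
  proof
    assume "gfo_le (word_of (E (n - 1))) (emb_reduce w l)"
    then obtain c where c: "occurs_at (u @ [1]) c (emb_reduce w l)"
      unfolding wn gfo_le_iff by auto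
    have "u ! y \<le> emb_reduce w l ! (c + y)" if "y < length u" for y
      using c that by (auto simp: occurs_at_def nth_append dest!: spec[of _ y])
    then have o: "occurs_at u c (emb_reduce w l)" "c + length u < length w"
      using c by (auto simp: occurs_at_def)
    then have "c = 0" using split[OF occurs_at_mono[OF o(1) emb_reduce_le]] by auto
    then show False using o nb[of 0 l] l n0 by (simp add: E_def)
  qed
  show "\<not> gfo_le u (emb_reduce (E k) l)"
    if k: "0 < k" "k < n" "l < ls ! k" "reducible (E k) l" for k l
  proof
    assume "gfo_le u (emb_reduce (E k) l)"
    then obtain c where c: "occurs_at u c (emb_reduce (E k) l)" by (auto simp: gfo_le_iff)
    then have ck: "occurs_at u c (E k)" using occurs_at_mono emb_reduce_le by blast
    have c1: "occurs_at u c (E 1)"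
      using occurs_at_mono[OF ck] chain_emb_antimono[of 1 k ls w] k by (simp add: E_def n_def)
    have "occurs_at u c w"
      using occurs_at_mono[OF c1] emb_reduce_le[of w "ls ! 0"] E1 by simp
    moreover have "c \<noteq> 0" using nb[of k l] k c by (auto intro: ccontr)
    ultimately have ceq: "c = length w - length u" using split by blast
    have up: "\<And>y. y < length u \<Longrightarrow> u ! y \<ge> 1" using u by (simp add: Pstar_iff)
    \<comment> \<open>If the last letter survives, the first step deletes nothing, since
      \<open>pos\<close> excludes the front; then \<open>E 1\<close> is itself a word, and a
      surviving occurrence at the end would be a suffix of it.\<close>
    from supported_Pstar[OF assms(4)] r have "E 1 ! (length w - 1) \<noteq> 0 \<longrightarrow> word_of (E 1) = E 1"
    proof (cases rule: reducible_cases)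
      case big
      then show ?thesis using word_of_supported(1)[OF big(3)] E1 by simp
    qed (use pos E1 in \<open>auto simp: nth_emb_reduce\<close>)
    moreover have "E 1 ! (length w - 1) \<noteq> 0"
    proof -
      have y: "length u - 1 < length u" using une by simp
      then have "c + (length u - 1) = length w - 1" using ceq lu by linarith
      then have "u ! (length u - 1) \<le> E 1 ! (length w - 1)" using c1 y unfolding occurs_at_def by metis
      then show ?thesis using up[OF y] by linarith
    qed
    ultimately have "is_suffix u (word_reduce w (ls ! 0))"
      using c1 ceq lu lenE[of 1] E1 by (simp add: word_reduce_eq is_suffix_iff)
    then show False using ns by simp
  qed
qed

text \<open>An improvement that is absent from the tail must occur at the first step; this turns the
  three conjuncts into the conditions of the two preceding lemmas.\<close>

lemma minimal_improvable_iff: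
  assumes "w \<in> Pstar" "run w ls" "ls \<noteq> []"
  defines "n \<equiv> length ls" and "u \<equiv> word_of (chain_emb w ls (length ls))"
  shows "improvable w ls \<and> \<not> improvable (chain_emb w ls 1) (drop 1 ls) \<and>
      \<not> improvable w (take (n - 1) ls) \<longleftrightarrow>
    n = 2 \<and> ls ! 1 < ls ! 0 \<and> w \<noteq> u @ [1, 1] \<or>
    principal_factor u w \<and> ls ! 0 = principal_index u w \<and>
      chain_emb w ls n = prefix_embedding u w \<and> greedy w ls"
    (is "?min \<longleftrightarrow> ?a \<or> ?b")
proof -
  note con = contiguous_Pstar[OF assms(1)]
  have n: "n \<ge> 1" using assms(3) by (cases ls) (auto simp: n_def)
  have imp: "improvable w ls \<longleftrightarrow> (\<exists>k<n. \<exists>l<ls ! k. reducible (chain_emb w ls k) l \<and>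
     gfo_le u (emb_reduce (chain_emb w ls k) l))"
    by (simp add: improvable_def n_def u_def)
  have tail: "improvable (chain_emb w ls 1) (drop 1 ls) \<longleftrightarrow>
    (\<exists>k. 1 \<le> k \<and> k < n \<and> (\<exists>l<ls ! k. reducible (chain_emb w ls k) l \<and>
      gfo_le u (emb_reduce (chain_emb w ls k) l)))"
    using improvable_segment[of 1 n ls w] n by (simp add: n_def u_def)
  have butl: "improvable w (take (n - 1) ls) \<longleftrightarrow>
    (\<exists>k. k < n - 1 \<and> (\<exists>l<ls ! k. reducible (chain_emb w ls k) l \<and>
      gfo_le (word_of (chain_emb w ls (n - 1))) (emb_reduce (chain_emb w ls k) l)))"
    using improvable_segment[of 0 "n - 1" ls w] n by (simp add: n_def)
  have un: "gfo_le u (word_of (chain_emb w ls (n - 1)))"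
    using gfo_le_chain_emb[OF con assms(2), of "n - 1" n]
    by (simp add: u_def n_def gfo_le_contiguous contiguous_chain_emb[OF con assms(2)] word_of_Pstar)
  have minI: ?min
    if c1: "\<exists>l<ls ! 0. reducible w l \<and> gfo_le u (emb_reduce w l)"
      and c2: "\<And>l. l < ls ! 0 \<Longrightarrow> reducible w l \<Longrightarrow>
        \<not> gfo_le (word_of (chain_emb w ls (n - 1))) (emb_reduce w l)"
      and c3: "\<And>k l. 0 < k \<Longrightarrow> k < n \<Longrightarrow> l < ls ! k \<Longrightarrow> reducible (chain_emb w ls k) l \<Longrightarrow>
        \<not> gfo_le u (emb_reduce (chain_emb w ls k) l)"
  proof (intro conjI)
    show "improvable w ls" unfolding imp using c1 n by (intro exI[of _ 0]) auto
    show "\<not> improvable (chain_emb w ls 1) (drop 1 ls)" unfolding tail using c3 by auto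
    show "\<not> improvable w (take (n - 1) ls)"
    proof
      assume "improvable w (take (n - 1) ls)"
      then obtain k l where k: "k < n - 1" "l < ls ! k" "reducible (chain_emb w ls k) l"
        "gfo_le (word_of (chain_emb w ls (n - 1))) (emb_reduce (chain_emb w ls k) l)"
        unfolding butl by auto
      then show False
        using c2[of l] c3[of k l] gfo_le_trans[OF un k(4)]
        by (cases "k = 0") (auto simp: less_diff_conv)
    qed
  qed
  show ?thesis
  proof
    assume min: ?min
    then have n2: "2 \<le> n" using improvable_length[OF con assms(2)] by (simp add: n_def)
    have c1: "\<exists>l<ls ! 0. reducible w l \<and> gfo_le u (emb_reduce w l)"
    proof -
      obtain k l where k: "k < n" "l < ls ! k" "reducible (chain_emb w ls k) l"
        "gfo_le u (emb_reduce (chain_emb w ls k) l)" using min unfolding imp by auto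
      then have "k = 0" using min unfolding tail by (metis One_nat_def Suc_leI neq0_conv)
      then show ?thesis using k by auto
    qed
    have c2: "\<not> gfo_le (word_of (chain_emb w ls (n - 1))) (emb_reduce w l)"
      if "l < ls ! 0" "reducible w l" for l
    proof -
      have "0 < n - 1" using n2 by simp
      then show ?thesis using min that chain_emb_0 unfolding butl by metis
    qed
    have c3: "\<not> gfo_le u (emb_reduce (chain_emb w ls k) l)"
      if "0 < k" "k < n" "l < ls ! k" "reducible (chain_emb w ls k) l" for k l
      using min that unfolding tail by auto
    show "?a \<or> ?b"
      using minimal_improvable_imp[OF assms(1,2) n2[unfolded n_def]] c1 c2 c3
      by (simp add: n_def u_def)
  next
    assume "?a \<or> ?b"
    then show ?min
    proof
      assume a: ?a
      have r: "reducible w (ls ! 0)" "reducible (emb_reduce w (ls ! 0)) (ls ! 1)"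
        using run_first_two[OF assms(2)] a by (auto simp: n_def)
      have ueq: "u = word_of (emb_reduce (emb_reduce w (ls ! 0)) (ls ! 1))"
        using a by (simp add: u_def n_def numeral_2_eq_2 chain_emb_Suc)
      \<comment> \<open>This is \<open>rigid_descent_word\<close> read backwards:
        \<open>w \<noteq> u @ [1, 1]\<close> makes the descent swappable.\<close>
      have r1: "reducible w (ls ! 1)"
        using rigid_descent_word[OF assms(1) r] a ueq by metis
      have n2: "length ls = 2" using a by (simp add: n_def)
      have "gfo_le u (emb_reduce w (ls ! 1))"
      proof (rule gfo_le_mono)
        show "list_all2 (\<le>) (chain_emb w ls 2) (emb_reduce w (ls ! 1))"
          using le_swapped[of 0 ls w] a assms(2) n2 by (simp add: numeral_2_eq_2)
        show "gfo_le u (chain_emb w ls 2)"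
          using gfo_le_chain_emb[OF con assms(2), of 2 2] n2 by (simp add: u_def)
      qed
      then have "improvable w ls" unfolding imp using a r1 by (intro exI[of _ 0]) auto
      \<comment> \<open>Removing either end leaves a single step, which cannot be improved.\<close>
      moreover have "\<not> improvable (chain_emb w ls 1) (drop 1 ls)"
        using improvable_length[OF contiguous_chain_emb[OF con assms(2), of 1] run_drop[OF assms(2), of 1]] n2
        by auto
      moreover have "\<not> improvable w (take (n - 1) ls)"
        using improvable_length[OF con run_take[OF assms(2)], of "n - 1"] a by (auto simp: n_def)
      ultimately show ?thesis by simp
    next
      assume b: ?b
      have "principal_factor (word_of (chain_emb w ls (length ls))) w"
        "chain_emb w ls (length ls) = prefix_embedding (word_of (chain_emb w ls (length ls))) w"
        "greedy w ls" using b by (auto simp: u_def n_def)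
      note p = principal_imp_minimal[OF assms(1,2) this]
      show ?min using minI p(1-3) by (simp add: u_def n_def)
    qed
  qed
qed

section \<open>Passing to subchains\<close>

lemma run_length_eq:
  assumes "run w ls" "run w ls'"
    and "word_of (chain_emb w ls (length ls)) = word_of (chain_emb w ls' (length ls'))"
  shows "length ls = length ls'"
proof -
  have "sum_list (chain_emb w ls (length ls)) = sum_list (chain_emb w ls' (length ls'))"
    using arg_cong[OF assms(3), of sum_list] by (simp add: sum_list_word_of)
  then show ?thesis
    using sum_list_chain_emb[OF assms(1) order_refl] sum_list_chain_emb[OF assms(2) order_refl] by linarith
qed

text \<open>A violation of greediness extends by \<open>run_to_embedding\<close> to an earlier chain
  with the same final embedding; this is where non-flatness enters. Conversely, an earlier chain to
  the same embedding violates greediness at the first difference of the ids.\<close>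

lemma first_admissible_iff_greedy:
  assumes "w \<in> Pstar" "run w ls" "u = word_of (chain_emb w ls (length ls))" "\<not> flat u"
  shows "first_admissible u w \<eta> (run_words w ls) \<longleftrightarrow>
    chain_emb w ls (length ls) = \<eta> \<and> greedy w ls"
proof -
  note con = contiguous_Pstar[OF assms(1)]
  have mc: "maximal_chain u w (run_words w ls)" and ci: "chain_id (run_words w ls) ls"
    using maximal_chain_run_words[OF assms(1,2)] assms(3) by auto
  \<comment> \<open>Since ids are unique, the existential quantifiers in \<open>earlier\<close> and
    \<open>ends_at\<close> refer to known lists.\<close>
  have ids: "ks = ls'" if "run w ls'" "maximal_chain u w (run_words w ls')"
    "chain_id (run_words w ls') ks" for ks ls'
  proof -
    have "run w ks" "run_words w ls' = run_words w ks"
      using chain_id_iff_run[OF assms(1), of u "run_words w ls'" ks] that(2,3) by blast+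
    then show ?thesis using run_words_inject[OF con that(1)] by simp
  qed
  have hd: "hd (run_words w ls) = w" using mc by (simp add: maximal_chain_def)
  have ends: "ends_at (run_words w ls) \<eta> \<longleftrightarrow> chain_emb w ls (length ls) = \<eta>"
    unfolding ends_at_def hd using ids[OF assms(2) mc] ci by blast
  show ?thesis
  proof
    assume fa: "first_admissible u w \<eta> (run_words w ls)"
    then have \<eta>: "chain_emb w ls (length ls) = \<eta>" using ends by (simp add: first_admissible_def)
    have "greedy w ls"
      unfolding greedy_def
    proof (intro allI impI notI)
      fix k l assume k: "k < length ls" "l < ls ! k" "reducible (chain_emb w ls k) l"
        and le: "list_all2 (\<le>) (chain_emb w ls (length ls)) (emb_reduce (chain_emb w ls k) l)"
      have "contiguous (emb_reduce (chain_emb w ls k) l)" "contiguous (chain_emb w ls (length ls))"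
        using contiguous_reduce contiguous_chain_emb[OF con assms(2)] k by auto
      from run_to_embedding[OF this le] assms(3,4)
      obtain ks where ks: "run (emb_reduce (chain_emb w ls k) l) ks"
        "chain_emb (emb_reduce (chain_emb w ls k) l) ks (length ks) = \<eta>" using \<eta> by auto
      define ls' where "ls' = take k ls @ l # ks"
      have r: "run w ls'"
        using ks k run_take[OF assms(2)] by (simp add: ls'_def run_append chain_emb_take min_absorb2)
      have e: "chain_emb w ls' (length ls') = \<eta>"
        using ks(2) by (simp add: chain_emb_def) (simp add: ls'_def)
      have u': "u = word_of (chain_emb w ls' (length ls'))" using e \<eta> assms(3) by simp
      note mc' = maximal_chain_run_words[OF assms(1) r, folded u']
      have nth: "ls' ! k = l" using k by (simp add: ls'_def nth_append)
      have "(ls', ls) \<in> lexord less_than"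
        using k nth by (intro lexord_at[of k]) (auto simp: ls'_def)
      moreover have "ls' \<noteq> ls" using k nth by auto
      moreover have "run_words w ls' \<noteq> run_words w ls"
        using run_words_inject[OF con r assms(2)] \<open>ls' \<noteq> ls\<close> by blast
      moreover have "ends_at (run_words w ls') \<eta>"
        using mc' e unfolding ends_at_def maximal_chain_def by (intro exI[of _ ls']) simp
      ultimately have "earlier (run_words w ls) (run_words w ls')"
        using fa mc' by (simp add: first_admissible_def)
      then obtain a b where ab: "chain_id (run_words w ls) a" "chain_id (run_words w ls') b"
        "(a, b) \<in> lexord less_than" by (auto simp: earlier_def)
      then have "a = ls" "b = ls'" using ids[OF assms(2) mc] ids[OF r mc'(1)] by auto
      then have "(ls, ls') \<in> lexord less_than" using ab by simp
      with \<open>(ls', ls) \<in> lexord less_than\<close> show False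
        using lexord_trans[of ls' ls less_than ls'] lexord_irreflexive[of less_than ls']
        by (metis less_not_refl less_than_iff trans_less_than)
    qed
    with \<eta> show "chain_emb w ls (length ls) = \<eta> \<and> greedy w ls" by simp
  next
    assume g: "chain_emb w ls (length ls) = \<eta> \<and> greedy w ls"
    show "first_admissible u w \<eta> (run_words w ls)"
      unfolding first_admissible_def
    proof (intro conjI allI impI mc)
      show "ends_at (run_words w ls) \<eta>" using ends g by simp
      fix vs' assume vs': "maximal_chain u w vs' \<and> ends_at vs' \<eta> \<and> vs' \<noteq> run_words w ls"
      then obtain ls' where ls': "chain_id vs' ls'" "chain_emb w ls' (length ls') = \<eta>"
        by (auto simp: ends_at_def maximal_chain_def)
      then have r: "run w ls'" "vs' = run_words w ls'"
        using chain_id_iff_run[OF assms(1), of u vs' ls'] vs' by auto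
      have len: "length ls' = length ls" using run_length_eq[OF r(1) assms(2)] ls' g by simp
      have "ls' \<noteq> ls" using r vs' by auto
      then consider "(ls, ls') \<in> lexord less_than" | "(ls', ls) \<in> lexord less_than"
        using total_lexord[OF total_less_than] unfolding total_on_def by blast
      then show "earlier (run_words w ls) vs'"
      proof cases
        case 1
        then show ?thesis using ci ls' by (auto simp: earlier_def)
      next
        case 2
        obtain k where k: "k < length ls" "take k ls' = take k ls" "ls' ! k < ls ! k"
          using lexord_first_difference[OF 2 len] .
        then have E: "chain_emb w ls' k = chain_emb w ls k" by (simp add: chain_emb_def)
        have "reducible (chain_emb w ls k) (ls' ! k)"
          using r(1) k len E by (metis run_nth)
        moreover have "list_all2 (\<le>) (chain_emb w ls' (length ls')) (chain_emb w ls' (Suc k))"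
          using k len by (intro chain_emb_antimono) auto
        moreover have "chain_emb w ls' (Suc k) = emb_reduce (chain_emb w ls k) (ls' ! k)"
          using k len E by (simp add: chain_emb_Suc)
        ultimately have False using g k(1,3) ls'(2) unfolding greedy_def by metis
        then show ?thesis ..
      qed
    qed
  qed
qed

section \<open>Shifting a chain by surrounding zeros\<close>

definition pad :: "nat \<Rightarrow> nat \<Rightarrow> nat list \<Rightarrow> nat list" where
  "pad a b e = replicate a 0 @ e @ replicate b 0"

lemma emb_reduce_pad: "k < length e \<Longrightarrow> emb_reduce (pad a b e) (a + k) = pad a b (emb_reduce e k)"
  by (intro nth_equalityI) (auto simp: nth_emb_reduce pad_def nth_append)

lemma reducible_pad: "reducible (pad a b e) x \<longleftrightarrow> a \<le> x \<and> reducible e (x - a)"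
proof -
  have w: "word_of (pad a b e) = word_of e" by (simp add: pad_def word_of_padded)
  have nth: "pad a b e ! x = (if x < a then 0 else if x < a + length e then e ! (x - a) else 0)"
    if "x < a + length e + b" for x using that by (auto simp: pad_def nth_append)
  have len: "length (pad a b e) = a + length e + b" by (simp add: pad_def)
  show ?thesis
  proof
    assume r: "reducible (pad a b e) x"
    note rb = reducible_bounds[OF r]
    have ax: "a \<le> x" "x < a + length e" using rb nth[of x] len by (auto split: if_splits)
    have ex: "pad a b e ! x = e ! (x - a)" using nth[of x] ax by simp
    have "\<forall>i<x - a. e ! i = 0" if "\<forall>i<x. pad a b e ! i = 0"
    proof (intro allI impI)
      fix i assume "i < x - a"
      then show "e ! i = 0" using that[rule_format, of "a + i"] nth[of "a + i"] ax by simp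
    qed
    moreover have "\<forall>i. x - a < i \<and> i < length e \<longrightarrow> e ! i = 0"
      if "\<forall>i. x < i \<and> i < length (pad a b e) \<longrightarrow> pad a b e ! i = 0"
    proof (intro allI impI)
      fix i assume "x - a < i \<and> i < length e"
      then have "x < a + i" "i < length e" by auto
      then show "e ! i = 0" using that[rule_format, of "a + i"] nth[of "a + i"] len by simp
    qed
    ultimately show "a \<le> x \<and> reducible e (x - a)"
      using r ax ex unfolding reducible_def emb_reducible_def w by auto
  next
    assume r: "a \<le> x \<and> reducible e (x - a)"
    then have ax: "a \<le> x" "x < a + length e" using reducible_bounds[of e "x - a"] by auto
    have ex: "pad a b e ! x = e ! (x - a)" using nth[of x] ax by simp
    have "\<forall>i<x. pad a b e ! i = 0" if "\<forall>i<x - a. e ! i = 0"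
      using that nth ax by auto
    moreover have "\<forall>i. x < i \<and> i < length (pad a b e) \<longrightarrow> pad a b e ! i = 0"
      if "\<forall>i. x - a < i \<and> i < length e \<longrightarrow> e ! i = 0"
    proof (intro allI impI)
      fix i assume i: "x < i \<and> i < length (pad a b e)"
      then have "x - a < i - a" using ax by linarith
      then show "pad a b e ! i = 0" using that[rule_format, of "i - a"] nth[of i] i ax len by auto
    qed
    ultimately show "reducible (pad a b e) x"
      using r ax ex len unfolding reducible_def emb_reducible_def w by auto
  qed
qed

text \<open>The added zeros are never reducible and do not affect which letters are first or last,
  so every run is a shifted one.\<close>

lemma run_pad:
  assumes "run (pad a b e) ls"
  shows "\<exists>ls'. ls = map ((+) a) ls' \<and> run e ls' \<and>
    (\<forall>k. chain_emb (pad a b e) ls k = pad a b (chain_emb e ls' k))"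
  using assms
proof (induction ls arbitrary: e)
  case Nil
  then show ?case by (simp add: chain_emb_def)
next
  case (Cons x ls)
  then have x: "a \<le> x" "reducible e (x - a)" by (auto simp: reducible_pad)
  then have red: "emb_reduce (pad a b e) x = pad a b (emb_reduce e (x - a))"
    using emb_reduce_pad[of "x - a" e a b] reducible_bounds(1)[of e "x - a"] by simp
  then obtain ls' where ls': "ls = map ((+) a) ls'" "run (emb_reduce e (x - a)) ls'"
    "\<And>k. chain_emb (pad a b (emb_reduce e (x - a))) ls k = pad a b (chain_emb (emb_reduce e (x - a)) ls' k)"
    using Cons by auto
  have "chain_emb (pad a b e) (x # ls) k = pad a b (chain_emb e ((x - a) # ls') k)" for k
    using ls'(3) red by (cases k) auto
  then show ?case using x ls' by (intro exI[of _ "(x - a) # ls'"]) auto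
qed

lemma contiguous_pad: "contiguous e \<Longrightarrow> contiguous (pad a b e)"
proof -
  assume "contiguous e"
  then obtain c m where s: "supported e c m" by (auto simp: contiguous_def)
  have "pad a b e = replicate (a + c) 0 @ word_of e @ replicate (length e - c - m + b) 0"
    unfolding pad_def by (subst word_of_supported(1)[OF s]) (simp add: replicate_add)
  then show ?thesis using supported_padded[OF word_of_Pstar] unfolding contiguous_def by metis
qed

lemma improvable_pad:
  assumes "contiguous e" "run e ls"
    and pad: "\<And>k. chain_emb (pad a b e) (map ((+) a) ls) k = pad a b (chain_emb e ls k)"
  shows "improvable (pad a b e) (map ((+) a) ls) \<longleftrightarrow> improvable e ls"
proof -
  have word: "word_of (pad a b f) = word_of f" for f by (simp add: pad_def word_of_padded)
  have le: "gfo_le u (emb_reduce (pad a b (chain_emb e ls k)) (a + l)) \<longleftrightarrow>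
      gfo_le u (emb_reduce (chain_emb e ls k) l)"
    if "u \<in> Pstar" "k < length ls" "reducible (chain_emb e ls k) l" for u k l
  proof -
    have c: "contiguous (emb_reduce (chain_emb e ls k) l)"
      using contiguous_reduce contiguous_chain_emb[OF assms(1,2), of k] that by auto
    have "emb_reduce (pad a b (chain_emb e ls k)) (a + l) = pad a b (emb_reduce (chain_emb e ls k) l)"
      using emb_reduce_pad reducible_bounds(1)[OF that(3)] by simp
    then show ?thesis
      using gfo_le_contiguous[OF c that(1)] gfo_le_contiguous[OF contiguous_pad[OF c] that(1)] word
      by metis
  qed
  have "(\<exists>l<(map ((+) a) ls) ! k. reducible (chain_emb (pad a b e) (map ((+) a) ls) k) l \<and>
      gfo_le (word_of (chain_emb (pad a b e) (map ((+) a) ls) (length (map ((+) a) ls))))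
       (emb_reduce (chain_emb (pad a b e) (map ((+) a) ls) k) l)) \<longleftrightarrow>
    (\<exists>l<ls ! k. reducible (chain_emb e ls k) l \<and>
     gfo_le (word_of (chain_emb e ls (length ls))) (emb_reduce (chain_emb e ls k) l))"
    (is "?L \<longleftrightarrow> ?R") if k: "k < length ls" for k
  proof
    assume ?L
    then obtain l where l: "l < a + ls ! k" "reducible (pad a b (chain_emb e ls k)) l"
      "gfo_le (word_of (chain_emb e ls (length ls))) (emb_reduce (pad a b (chain_emb e ls k)) l)"
      using k pad word by auto
    then have "a \<le> l" "reducible (chain_emb e ls k) (l - a)" by (auto simp: reducible_pad)
    then show ?R using l le[OF word_of_Pstar k, of "l - a"] by (intro exI[of _ "l - a"]) auto
  next
    assume ?R
    then obtain l where l: "l < ls ! k" "reducible (chain_emb e ls k) l"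
     "gfo_le (word_of (chain_emb e ls (length ls))) (emb_reduce (chain_emb e ls k) l)" by auto
    then show ?L using k pad word le[OF word_of_Pstar k l(2)]
      by (intro exI[of _ "a + l"]) (auto simp: reducible_pad)
  qed
  note step = this[unfolded length_map]
  show ?thesis
    unfolding improvable_def length_map by (rule ex_cong1, rule conj_cong, rule refl, rule step)
qed

text \<open>Improvability passes to larger segments by \<open>improvable_segment_mono\<close>, so it
  suffices to test the two segments that are one step shorter at an end.\<close>

lemma minimally_skipped_iff_improvable:
  assumes "w \<in> Pstar" "run w ls" "u = word_of (chain_emb w ls (length ls))"
    and "i < j" "j \<le> length ls"
  shows "minimally_skipped u w (run_words w ls) i j \<longleftrightarrow>
    improvable (chain_emb w ls i) (take (j - i) (drop i ls)) \<and>
    \<not> improvable (chain_emb w ls (Suc i)) (take (j - Suc i) (drop (Suc i) ls)) \<and>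
    \<not> improvable (chain_emb w ls i) (take (j - 1 - i) (drop i ls))"
proof -
  let ?vs = "run_words w ls"
  let ?imp = "\<lambda>i j. improvable (chain_emb w ls i) (take (j - i) (drop i ls))"
  note con = contiguous_Pstar[OF assms(1)]
  have sk: "skipped u w ?vs i' j' \<longleftrightarrow> ?imp i' j'" if "i' < j'" "j' \<le> length ls" for i' j'
    using skipped_iff_improvable[OF assms(1-3) that] .
  have skD: "i' < j' \<and> j' \<le> length ls" if "skipped u w ?vs i' j'" for i' j'
    using that by (auto simp: skipped_def)
  have imp2: "2 \<le> j' - i'" if "?imp i' j'" "i' \<le> length ls" for i' j'
    using improvable_length[OF contiguous_chain_emb[OF con assms(2) that(2)]
        run_take[OF run_drop[OF assms(2) that(2)]] that(1)] by simp
  have mem: "?vs ! k \<in> open_int ?vs i' j' \<longleftrightarrow> i' < k \<and> k < j'"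
    if "k \<le> length ls" "j' \<le> Suc (length ls)" for k i' j'
  proof
    assume "?vs ! k \<in> open_int ?vs i' j'"
    then obtain m where m: "i' < m" "m < j'" "?vs ! k = ?vs ! m" by (auto simp: open_int_def)
    then have "k = m" using run_words_distinct[OF assms(2) that(1)] that(2) by simp
    then show "i' < k \<and> k < j'" using m by simp
  qed (auto simp: open_int_def)
  show ?thesis
  proof
    assume min: "minimally_skipped u w ?vs i j"
    then have skip: "?imp i j" using sk assms by (simp add: minimally_skipped_def)
    have no: "\<not> ?imp i' j'" if ij: "i \<le> i'" "j' \<le> j" "(i', j') \<noteq> (i, j)" for i' j'
    proof
      assume imp: "?imp i' j'"
      then have i': "i' \<le> length ls"
        by (cases "i' \<le> length ls") (auto simp: improvable_def)
      note i2 = imp2[OF imp i']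
      have "skipped u w ?vs i' j'" using sk imp i2 ij assms by simp
      moreover have "open_int ?vs i' j' \<subset> open_int ?vs i j"
      proof
        show "open_int ?vs i' j' \<subseteq> open_int ?vs i j" using ij unfolding open_int_def by force
        \<comment> \<open>A shorter segment loses the first or the last word of the open interval;
          these two indices witness that the inclusion is strict.\<close>
        have "Suc i \<le> length ls" "j - 1 \<le> length ls" "i < j - 1" "Suc i < j"
          using imp2[OF skip] assms by auto
        then show "open_int ?vs i' j' \<noteq> open_int ?vs i j"
          using mem[of "Suc i" j' i'] mem[of "Suc i" j i] mem[of "j - 1" j' i'] mem[of "j - 1" j i] ij assms(5)
          by (cases "i' = i") auto
      qed
      ultimately show False using min by (auto simp: minimally_skipped_def)
    qed
    show "?imp i j \<and> \<not> ?imp (Suc i) j \<and> \<not> improvable (chain_emb w ls i) (take (j - 1 - i) (drop i ls))"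
      using skip no[of "Suc i" j] no[of i "j - 1"] assms by auto
  next
    assume imp: "?imp i j \<and> \<not> ?imp (Suc i) j \<and>
      \<not> improvable (chain_emb w ls i) (take (j - 1 - i) (drop i ls))"
    have "\<not> open_int ?vs i' j' \<subset> open_int ?vs i j" if s: "skipped u w ?vs i' j'" for i' j'
    proof
      assume sub: "open_int ?vs i' j' \<subset> open_int ?vs i j"
      have ij': "i' < j'" "j' \<le> length ls" using skD[OF s] by auto
      have imp': "?imp i' j'" using sk[OF ij'] s by simp
      have i2: "2 \<le> j' - i'" using imp2[OF imp'] ij' by simp
      \<comment> \<open>The bounds are recovered from the inclusion of sets through the first and
        last inner words, which exist because the segment has at least two steps.\<close>
      have "?vs ! Suc i' \<in> open_int ?vs i' j'" "?vs ! (j' - 1) \<in> open_int ?vs i' j'"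
        using mem i2 ij' by auto
      then have "?vs ! Suc i' \<in> open_int ?vs i j" "?vs ! (j' - 1) \<in> open_int ?vs i j" using sub by auto
      then have "i < Suc i'" "j' - 1 < j" using mem i2 ij' assms(5) by auto
      then have le: "i \<le> i'" "j' \<le> j" by auto
      have "(i', j') \<noteq> (i, j)" using sub by auto
      then consider "Suc i \<le> i'" | "j' \<le> j - 1" using le by fastforce
      then show False
      proof cases
        case 1
        then show ?thesis
          using improvable_segment_mono[OF con assms(2) 1 less_imp_le[OF ij'(1)] le(2) assms(5) imp'] imp by simp
      next
        case 2
        then show ?thesis
          using improvable_segment_mono[OF con assms(2) le(1) less_imp_le[OF ij'(1)] 2 _ imp'] imp assms(5)
          by simp
      qed
    qed
    then show "minimally_skipped u w ?vs i j"
      using sk[OF assms(4,5)] imp unfolding minimally_skipped_def by blast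
  qed
qed

lemma emb_offset_pad: "v \<in> Pstar \<Longrightarrow> v \<noteq> [] \<Longrightarrow> emb_offset (pad a b v) = a"
proof -
  have "takeWhile (\<lambda>x. x = 0) (replicate a 0 @ ys) = replicate a 0 @ takeWhile (\<lambda>x. x = 0) ys"
    for ys :: "nat list"
    by (intro takeWhile_append2) simp
  then show "v \<in> Pstar \<Longrightarrow> v \<noteq> [] \<Longrightarrow> emb_offset (pad a b v) = a"
    by (cases v) (auto simp: emb_offset_def pad_def Pstar_def)
qed

text \<open>The words of a chain are distinct, so a singleton open interval determines both of its
  ends.\<close>

lemma single_strong_descent_iff:
  assumes "run w ls" "i < j" "j \<le> length ls"
  shows "(\<exists>k. strong_descent (run_words w ls) ls k \<and>
      open_int (run_words w ls) i j = {run_words w ls ! k}) \<longleftrightarrow>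
    j = Suc (Suc i) \<and> ls ! Suc i < ls ! i \<and> run_words w ls ! i \<noteq> run_words w ls ! j @ [1, 1]"
    (is "?L \<longleftrightarrow> ?R")
proof
  let ?vs = "run_words w ls"
  {
    assume ?L
    then obtain k where k: "strong_descent ?vs ls k" "open_int ?vs i j = {?vs ! k}" by auto
    then have kl: "k < length ls" "0 < k" by (auto simp: strong_descent_def descent_def)
    obtain m where m: "i < m" "m < j" using k(2) by (auto simp: open_int_def)
    have only: "m = k" if "i < m" "m < j" for m
    proof -
      have "?vs ! m \<in> open_int ?vs i j" using that by (auto simp: open_int_def)
      then have "?vs ! m = ?vs ! k" using k(2) by simp
      then show ?thesis using run_words_distinct[OF assms(1), of m k] that assms(3) kl by simp
    qed
    have "Suc i = k" "j - 1 = k" using only[of "Suc i"] only[of "j - 1"] m by auto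
    then have "j = Suc (Suc i)" "k = Suc i" using m by auto
    then show ?R using k(1) by (auto simp: strong_descent_def descent_def)
  next
    assume r: ?R
    have "open_int ?vs i j = {?vs ! Suc i}" using r by (auto simp: open_int_def less_Suc_eq)
    then show ?L using r assms(3)
      by (intro exI[of _ "Suc i"]) (auto simp: strong_descent_def descent_def)
  }
qed

theorem theorem3p9:
  fixes u w :: "nat list" and vs :: "nat list list" and ls :: "nat list" and i j :: nat
  assumes "u \<in> Pstar" and "w \<in> Pstar" and "gfo_le u w"
    and "maximal_chain u w vs" and "chain_id vs ls"
    and "i < j" and "j < length vs"
  shows "minimally_skipped u w vs i j \<longleftrightarrow>
    (\<exists>k. strong_descent vs ls k \<and> open_int vs i j = {vs ! k}) \<or>
    (principal_factor (vs ! j) (vs ! i) \<and>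
     ls ! i = emb_offset (chain_emb w ls i) + principal_index (vs ! j) (vs ! i) \<and>
     first_admissible (vs ! j) (vs ! i) (prefix_embedding (vs ! j) (vs ! i)) (subchain vs i j))"
proof -
  have r: "run w ls" and vs: "vs = run_words w ls" and u: "u = word_of (chain_emb w ls (length ls))"
    using chain_id_iff_run[OF assms(2)] assms(4,5) by auto
  note con = contiguous_Pstar[OF assms(2)]
  have j: "j \<le> length ls" using assms(7) vs by simp
  define v where "v = vs ! i"
  have v: "v = word_of (chain_emb w ls i)" using assms(6) j by (simp add: v_def vs)
  have vP: "v \<in> Pstar" by (simp add: v word_of_Pstar)
  \<comment> \<open>The segment is transported to start at the word \<open>v\<close> itself: its
    embedding is \<open>v\<close> with \<open>a\<close> zeros in front, so all positions of the
    segment drop by \<open>a\<close>, and \<open>a\<close> is the offset in the statement.\<close>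
  obtain a m where "supported (chain_emb w ls i) a m"
    using contiguous_chain_emb[OF con r, of i] assms(6) j by (auto simp: contiguous_def)
  from word_of_supported(1)[OF this] obtain b where E: "chain_emb w ls i = pad a b v"
    unfolding pad_def v by blast
  define L where "L = take (j - i) (drop i ls)"
  have "run (pad a b v) L"
    using run_take[OF run_drop[OF r, of i]] assms(6) j E by (simp add: L_def)
  from run_pad[OF this] obtain ks where L: "L = map ((+) a) ks" and rk: "run v ks"
    and pad: "\<And>k. chain_emb (pad a b v) L k = pad a b (chain_emb v ks k)" by auto
  have len: "length ks = j - i" using arg_cong[OF L, of length] assms(6) j by (simp add: L_def)
  have ksne: "ks \<noteq> []" using len assms(6) by auto
  have Ek: "chain_emb w ls (i + k) = pad a b (chain_emb v ks k)" if "k \<le> j - i" for k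
  proof -
    have "i + k \<le> length ls" using that j assms(6) by linarith
    then show ?thesis
      using pad[of k] that E chain_emb_drop[of i k ls w]
      by (simp add: L_def chain_emb_take)
  qed
  have lsk: "ls ! (i + k) = a + ks ! k" if "k < j - i" for k
    using arg_cong[OF L, of "\<lambda>x. x ! k"] that len j by (simp add: L_def)
  have vsk: "vs ! (i + k) = word_of (chain_emb v ks k)" if "k \<le> j - i" for k
  proof -
    have "i + k \<le> length ls" using that j assms(6) by linarith
    then show ?thesis using Ek[OF that] by (simp add: vs pad_def word_of_padded)
  qed
  have sub: "subchain vs i j = run_words v ks"
  proof (rule nth_equalityI)
    show "length (subchain vs i j) = length (run_words v ks)"
      using assms(6) len by (simp add: subchain_def)
    fix k assume "k < length (subchain vs i j)"
    then have "k \<le> j - i" using assms(6) by (simp add: subchain_def)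
    then show "subchain vs i j ! k = run_words v ks ! k"
      using vsk len assms(6) by (simp add: subchain_def nth_map nth_upt del: upt_Suc)
  qed
  define x where "x = word_of (chain_emb v ks (length ks))"
  have x: "vs ! j = x" using vsk[of "j - i"] assms(6) len by (simp add: x_def)
  have cv: "contiguous v" using contiguous_Pstar[OF vP] .
  have full: "improvable (chain_emb w ls i) (take (j - i) (drop i ls)) \<longleftrightarrow> improvable v ks"
    using improvable_pad[OF cv rk, of a b] pad L E by (simp add: L_def)
  have tail: "improvable (chain_emb w ls (Suc i)) (take (j - Suc i) (drop (Suc i) ls)) \<longleftrightarrow>
      improvable (chain_emb v ks 1) (drop 1 ks)"
  proof -
    have e: "chain_emb w ls (Suc i) = pad a b (chain_emb v ks 1)" using Ek[of 1] assms(6) by simp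
    have t: "take (j - Suc i) (drop (Suc i) ls) = map ((+) a) (drop 1 ks)"
      using arg_cong[OF L, of "drop 1"] by (simp add: L_def drop_take drop_map)
    have "chain_emb (pad a b (chain_emb v ks 1)) (map ((+) a) (drop 1 ks)) k =
        pad a b (chain_emb (chain_emb v ks 1) (drop 1 ks) k)" for k
      using pad[of "Suc k"] pad[of 1] L ksne
      by (cases ks) (auto simp: chain_emb_def)
    then show ?thesis
      unfolding e t
      by (intro improvable_pad contiguous_chain_emb[OF cv rk] run_drop[OF rk])
        (use ksne in \<open>auto simp: Suc_le_eq\<close>)
  qed
  have butl: "improvable (chain_emb w ls i) (take (j - 1 - i) (drop i ls)) \<longleftrightarrow>
      improvable v (take (length ks - 1) ks)"
  proof -
    have t: "take (j - 1 - i) (drop i ls) = map ((+) a) (take (length ks - 1) ks)"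
      using arg_cong[OF L, of "take (j - 1 - i)"] len by (simp add: L_def take_map min_absorb1 diff_commute)
    have "chain_emb (pad a b v) (map ((+) a) (take (length ks - 1) ks)) k =
        pad a b (chain_emb v (take (length ks - 1) ks) k)" for k
      using pad[of "min k (length ks - 1)"] L by (simp add: chain_emb_def take_map)
    then show ?thesis unfolding E t by (intro improvable_pad cv run_take[OF rk])
  qed
  have "minimally_skipped u w vs i j \<longleftrightarrow>
    length ks = 2 \<and> ks ! 1 < ks ! 0 \<and> v \<noteq> x @ [1, 1] \<or>
    principal_factor x v \<and> ks ! 0 = principal_index x v \<and>
      chain_emb v ks (length ks) = prefix_embedding x v \<and> greedy v ks"
    unfolding vs minimally_skipped_iff_improvable[OF assms(2) r u assms(6) j] full tail butl
    using minimal_improvable_iff[OF vP rk ksne] by (simp add: x_def)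
  moreover have "(\<exists>k. strong_descent vs ls k \<and> open_int vs i j = {vs ! k}) \<longleftrightarrow>
    length ks = 2 \<and> ks ! 1 < ks ! 0 \<and> v \<noteq> x @ [1, 1]"
    unfolding vs single_strong_descent_iff[OF r assms(6) j]
    using lsk[of 0] lsk[of 1] len x assms(6) unfolding v_def vs
    by (cases "j = Suc (Suc i)") auto
  moreover have "principal_factor (vs ! j) (vs ! i) \<and>
     ls ! i = emb_offset (chain_emb w ls i) + principal_index (vs ! j) (vs ! i) \<and>
     first_admissible (vs ! j) (vs ! i) (prefix_embedding (vs ! j) (vs ! i)) (subchain vs i j) \<longleftrightarrow>
    principal_factor x v \<and> ks ! 0 = principal_index x v \<and>
      chain_emb v ks (length ks) = prefix_embedding x v \<and> greedy v ks"
  proof (cases "principal_factor x v")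
    case True
    \<comment> \<open>A principal factor is non-flat and proper: the former turns first
      admissibility into greediness, the latter makes \<open>v\<close> nonempty so that its offset
      is \<open>a\<close>.\<close>
    then have nf: "\<not> flat x" and "v \<noteq> []"
      by (auto simp: principal_factor_def maximal_outer_factor_def outer_factor_def)
    then show ?thesis
      using first_admissible_iff_greedy[OF vP rk x_def nf] emb_offset_pad[OF vP \<open>v \<noteq> []\<close>]
        lsk[of 0] assms(6) sub x E unfolding v_def[symmetric] by auto
  next
    case False
    then show ?thesis using x unfolding v_def by simp
  qed
  ultimately show ?thesis by blast
qed

end
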